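(* Let $0<\varepsilon<1/2$ and $\delta>0$. There is a constant $A_0=A_0(\varepsilon,\delta)$ such that for every $A\ge A_0$ the following holds for all integers $n\ge2$. Let $w_1,\dots,w_n$ be real numbers with $\sum_{i=1}^n w_i=0$, $\sum_{i=1}^n w_i^2=1$, and $|w_i-w_j|\le\frac{1}{A\sqrt{\log n}}$ for all distinct $i,j$. Assume moreover that no interval of length $\varepsilon/\sqrt n$ contains more than $(1-\varepsilon)n$ of the values $w_i$ (i.e. $w_i$ lies in the interval for more than $(1-\varepsilon)n$ indices $i$). Let $I\subset[n]$ with $|I|\ge\delta n$, and let $(v_1,\dots,v_n)$ be a real sequence with $v_i=i/n$ for all $i\in I$ (and $v_i$ arbitrary for $i\notin I$). Let $S_\pi=\sum_{i=1}^n w_iv_{\pi(i)}$, where $\pi$ is a uniformly random permutation of $[n]$. (a) There is a constant $K$ depending only on $A,\varepsilon,\delta$ such that for every $L\in\mathbb{R}$, $$\mathbb{P}\Big(|S_\pi-L|\le\frac{1}{n^{3/2}}\Big)\le\frac{K}{n^{3/2}}.$$ (b) If in addition $|v_i|\le\widetilde B$ for all $i\in[n]$, for some constant $\widetilde B>0$, then there are constants $K',c>0$ depending only on $A,\widetilde B,\varepsilon,\delta$ such that for every $L\in\mathbb{R}$, $$\mathbb{P}\Big(|S_\pi-L|\le\frac{1}{n^{3/2-\varepsilon}}\Big)\le\frac{K'}{n^{3/2-\varepsilon}}e^{-cL^2}.$$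
   Context: $[n]=\{1,\dots,n\}$. *)

theory Defs
  imports "HOL-Probability.Probability"
begin

definition perm_pmf :: "nat \<Rightarrow> (nat \<Rightarrow> nat) pmf" where
  "perm_pmf n = pmf_of_set {\<pi>. \<pi> permutes {1..n}}"

definition perm_sum :: "nat \<Rightarrow> (nat \<Rightarrow> real) \<Rightarrow> (nat \<Rightarrow> real) \<Rightarrow> (nat \<Rightarrow> nat) \<Rightarrow> real" where
  "perm_sum n w v \<pi> = (\<Sum>i=1..n. w i * v (\<pi> i))"

text \<open>
  Sequences indexed by [n] are total functions on the naturals of which only the values
  on \<open>{1..n}\<close> are used. In \<open>weights_ok\<close> it suffices to consider closed intervals, since
  every interval of a given length lies in a closed interval of the same length.
\<close>

definition weights_ok :: "real \<Rightarrow> real \<Rightarrow> nat \<Rightarrow> (nat \<Rightarrow> real) \<Rightarrow> bool" where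
  "weights_ok \<epsilon> A n w \<longleftrightarrow>
     (\<Sum>i=1..n. w i) = 0 \<and>
     (\<Sum>i=1..n. (w i)\<^sup>2) = 1 \<and>
     (\<forall>i\<in>{1..n}. \<forall>j\<in>{1..n}. i \<noteq> j \<longrightarrow> \<bar>w i - w j\<bar> \<le> 1 / (A * sqrt (ln (real n)))) \<and>
     (\<forall>a. real (card {i\<in>{1..n}. w i \<in> {a..a + \<epsilon> / sqrt (real n)}}) \<le> (1 - \<epsilon>) * real n)"

definition values_ok :: "real \<Rightarrow> nat \<Rightarrow> nat set \<Rightarrow> (nat \<Rightarrow> real) \<Rightarrow> bool" where
  "values_ok \<delta> n I v \<longleftrightarrow>
     I \<subseteq> {1..n} \<and> real (card I) \<ge> \<delta> * real n \<and> (\<forall>i\<in>I. v i = real i / real n)"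

end

theory Submission
  imports Defs
begin

text \<open>
  By smoothing with a tent function, \<open>P(\<bar>S - L\<bar> \<le> r)\<close> is at most a constant times the average of
  \<open>\<bar>E cos (t (S - L))\<bar>\<close> over \<open>0 \<le> t \<le> 1/r\<close>. The interval hypothesis yields linearly many disjoint pairs
  of positions \<open>a, b\<close> with \<open>\<bar>w a - w b\<bar>\<close> of order \<open>1 / sqrt n\<close>; exchanging the two values of each pair
  bounds the expectation by a product of factors \<open>\<bar>cos (t (w a - w b) (v x - v y) / 2)\<bar>\<close>, and since many
  values lie on the grid \<open>i / n\<close>, each factor is on average at most \<open>exp (- c min (t\<^sup>2 / n) 1)\<close> for \<open>t\<close>
  up to order \<open>n powr (3/2)\<close>. This works uniformly after conditioning on the values at any set \<open>T\<close>
  of few positions. For (b), split the positions into boundedly many such sets: if \<open>S\<close> is close to \<open>L\<close>,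
  then one of the centred partial sums is of order \<open>\<bar>L\<bar>\<close>, which has subgaussian probability, and
  conditionally on it the small ball estimate still holds.
\<close>

section \<open>Averages over random permutations\<close>

text \<open>A random ordering of \<open>Q\<close> is a list, not a bijection, so that values can be
  revealed one at a time: once the head is fixed, the tail is again a uniform ordering of what is
  left.\<close>

definition perm_avg :: "'a set \<Rightarrow> ('a list \<Rightarrow> real) \<Rightarrow> real" where
  "perm_avg Q f = (\<Sum>xs\<in>permutations_of_set Q. f xs) / fact (card Q)"

text \<open>Entries beyond the shorter list are ignored, so a short weight list evaluates the
  partial sum over an initial segment of positions.\<close>

fun wsum :: "('a \<Rightarrow> real) \<Rightarrow> real list \<Rightarrow> 'a list \<Rightarrow> real" where
  "wsum v (w # ws) (x # xs) = w * v x + wsum v ws xs"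
| "wsum v _ _ = 0"

lemma wsum_append:
  "length us = length ys \<Longrightarrow> wsum v (us @ ws) (ys @ zs) = wsum v us ys + wsum v ws zs"
  by (induction us ys rule: list_induct2) auto

lemma wsum_take: "wsum v us (take (length us) xs) = wsum v us xs"
  by (induction v us xs rule: wsum.induct) auto

lemma wsum_map_map: "wsum v (map w ps) (map f ps) = (\<Sum>p\<leftarrow>ps. w p * v (f p))"
  by (induction ps) auto

text \<open>Conditioning on the first entry, which is uniform on \<open>Q\<close>.\<close>

lemma perm_avg_rec:
  assumes "finite Q" "Q \<noteq> {}"
  shows "perm_avg Q f = (\<Sum>x\<in>Q. perm_avg (Q - {x}) (\<lambda>xs. f (x # xs))) / real (card Q)"
proof -
  have "(\<Sum>xs\<in>permutations_of_set Q. f xs) =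
      (\<Sum>x\<in>Q. \<Sum>xs\<in>permutations_of_set (Q - {x}). f (x # xs))"
    unfolding permutations_of_set_nonempty[OF assms(2)]
    by (subst sum.UNION_disjoint) (auto simp: assms sum.reindex)
  also have "\<dots> = (\<Sum>x\<in>Q. fact (card Q - 1) * perm_avg (Q - {x}) (\<lambda>xs. f (x # xs)))"
    using assms by (intro sum.cong) (auto simp: perm_avg_def)
  also have "\<dots> = fact (card Q - 1) * (\<Sum>x\<in>Q. perm_avg (Q - {x}) (\<lambda>xs. f (x # xs)))"
    by (simp add: sum_distrib_left)
  finally show ?thesis
    using assms by (simp add: perm_avg_def fact_reduce[of "card Q"] card_gt_0_iff)
qed

lemma perm_avg_mono:
  "(\<And>xs. xs \<in> permutations_of_set Q \<Longrightarrow> f xs \<le> g xs) \<Longrightarrow> perm_avg Q f \<le> perm_avg Q g"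
  unfolding perm_avg_def by (intro divide_right_mono sum_mono) auto

lemma perm_avg_const [simp]: "finite Q \<Longrightarrow> perm_avg Q (\<lambda>_. c) = c"
  by (simp add: perm_avg_def)

lemma perm_avg_add: "perm_avg Q (\<lambda>xs. f xs + g xs) = perm_avg Q f + perm_avg Q g"
  by (simp add: perm_avg_def sum.distrib add_divide_distrib)

lemma perm_avg_cmult: "perm_avg Q (\<lambda>xs. c * f xs) = c * perm_avg Q f"
  by (simp add: perm_avg_def sum_distrib_left)

text \<open>Conditioning on the first \<open>k\<close> values: \<open>g\<close> sees only these, and
  \<open>h\<close> has conditional average at most \<open>M\<close> whatever they are. This
  multiplies a tail probability for a few positions by a small ball bound for the others.\<close>

lemma perm_avg_prefix_le:
  assumes "finite Q" "k \<le> card Q" "\<And>ys. g ys \<ge> 0"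
    and "\<And>ys. length ys = k \<Longrightarrow> distinct ys \<Longrightarrow> set ys \<subseteq> Q \<Longrightarrow>
           perm_avg (Q - set ys) (\<lambda>zs. h (ys @ zs)) \<le> M"
  shows "perm_avg Q (\<lambda>xs. g (take k xs) * h xs) \<le> perm_avg Q (\<lambda>xs. g (take k xs)) * M"
  using assms
proof (induction k arbitrary: Q g h)
  case 0
  have "perm_avg Q h \<le> M"
    using "0.prems"(4)[of "[]"] by simp
  thus ?case
    using "0.prems" by (simp add: perm_avg_cmult mult_left_mono)
next
  case (Suc k)
  have ne: "Q \<noteq> {}" using Suc.prems by auto
  have "perm_avg (Q - {x}) (\<lambda>xs. g (x # take k xs) * h (x # xs))
      \<le> perm_avg (Q - {x}) (\<lambda>xs. g (x # take k xs)) * M" if x: "x \<in> Q" for x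
  proof (rule Suc.IH)
    fix ys :: "'a list" assume ys: "length ys = k" "distinct ys" "set ys \<subseteq> Q - {x}"
    have "perm_avg (Q - set (x # ys)) (\<lambda>zs. h ((x # ys) @ zs)) \<le> M"
      using ys x by (intro Suc.prems(4)) auto
    moreover have "Q - set (x # ys) = Q - {x} - set ys" by auto
    ultimately show "perm_avg (Q - {x} - set ys) (\<lambda>zs. h (x # ys @ zs)) \<le> M"
      by simp
  qed (use Suc.prems x in auto)
  hence "(\<Sum>x\<in>Q. perm_avg (Q - {x}) (\<lambda>xs. g (x # take k xs) * h (x # xs)))
      \<le> (\<Sum>x\<in>Q. perm_avg (Q - {x}) (\<lambda>xs. g (x # take k xs))) * M"
    by (simp add: sum_distrib_right sum_mono)
  thus ?case
    using Suc.prems(1) ne by (simp add: perm_avg_rec divide_right_mono)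
qed

text \<open>A random permutation read along any fixed enumeration \<open>ps\<close> of the positions
  is a uniform ordering. The free choice of \<open>ps\<close> allows paired or conditioned positions
  to be put first.\<close>

lemma prob_perm_pmf:
  assumes "distinct ps" "set ps = {1..n}"
  shows "measure_pmf.prob (perm_pmf n) {\<pi>. P (map \<pi> ps)} =
    perm_avg {1..n} (\<lambda>xs. of_bool (P xs))"
proof -
  let ?S = "{\<pi>. \<pi> permutes {1..n}}"
  let ?F = "\<lambda>\<pi>. map \<pi> ps"
  have len: "length ps = n"
    using distinct_card[OF assms(1)] assms(2) by simp
  have inj: "inj_on ?F ?S"
  proof (rule inj_onI, simp only: mem_Collect_eq)
    fix f g assume f: "f permutes {1..n}" and g: "g permutes {1..n}" and eq: "map f ps = map g ps"
    show "f = g"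
    proof
      fix x show "f x = g x"
        using eq f g assms(2) by (cases "x \<in> {1..n}") (auto simp: permutes_not_in)
    qed
  qed
  have sub: "?F ` ?S \<subseteq> permutations_of_set {1..n}"
  proof safe
    fix f assume f: "f permutes {1..n}"
    have "inj_on f (set ps)" using permutes_inj_on[OF f] .
    thus "map f ps \<in> permutations_of_set {1..n}"
      using assms permutes_image[OF f] by (intro permutations_of_setI) (auto simp: distinct_map)
  qed
  have card: "card ?S = fact n"
    by (rule card_permutations) auto
  have fin: "finite ?S" by (rule finite_permutations) auto
  have im: "?F ` ?S = permutations_of_set {1..n}"
    by (intro card_subset_eq sub) (simp_all add: card_image[OF inj] card del: One_nat_def)
  have "?S \<noteq> {}" using permutes_id by blast
  hence "measure_pmf.prob (perm_pmf n) {\<pi>. P (map \<pi> ps)} =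
      real (card (?S \<inter> {\<pi>. P (map \<pi> ps)})) / fact n"
    unfolding perm_pmf_def by (subst measure_pmf_of_set) (use fin card in auto)
  also have "real (card (?S \<inter> {\<pi>. P (map \<pi> ps)})) = (\<Sum>\<pi>\<in>?S. of_bool (P (?F \<pi>)))"
    using fin by (simp add: of_bool_def sum.If_cases)
  also have "\<dots> = (\<Sum>xs\<in>permutations_of_set {1..n}. of_bool (P xs))"
    unfolding im[symmetric] by (subst sum.reindex[OF inj]) auto
  finally show ?thesis by (simp add: perm_avg_def)
qed

section \<open>Exchanging values at paired positions\<close>

lemma perm_avg_rec2:
  assumes "finite Q" "card Q \<ge> 2"
  shows "perm_avg Q f = (\<Sum>x\<in>Q. \<Sum>y\<in>Q-{x}. perm_avg (Q - {x,y}) (\<lambda>xs. f (x # y # xs)))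
           / (real (card Q) * (real (card Q) - 1))"
proof -
  have ne: "Q \<noteq> {}" using assms by auto
  have "perm_avg (Q - {x}) (\<lambda>xs. f (x # xs)) =
      (\<Sum>y\<in>Q-{x}. perm_avg (Q - {x,y}) (\<lambda>xs. f (x # y # xs))) / (real (card Q) - 1)"
    if "x \<in> Q" for x
  proof -
    have "card (Q - {x}) \<noteq> 0" using assms(2) card_Diff_singleton[OF that] by simp
    hence "Q - {x} \<noteq> {}" by force
    moreover have "Q - {x} - {y} = Q - {x,y}" for y by auto
    ultimately show ?thesis
      using assms that by (subst perm_avg_rec) auto
  qed
  thus ?thesis
    using assms ne by (simp add: perm_avg_rec[of Q] sum_divide_distrib[symmetric])
qed

lemma sum_pairs_swap:
  assumes "finite Q"
  shows "(\<Sum>x\<in>Q. \<Sum>y\<in>Q-{x}. g x y) = (\<Sum>x\<in>Q. \<Sum>y\<in>Q-{x}. g y (x :: 'a) :: real)"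
proof -
  have eq: "(\<Sum>x\<in>Q. \<Sum>y\<in>Q-{x}. h x y) = (\<Sum>x\<in>Q. \<Sum>y\<in>Q. if x \<noteq> y then h x y else 0)"
    for h :: "'a \<Rightarrow> 'a \<Rightarrow> real"
    using assms by (intro sum.cong refl sum.mono_neutral_cong_left) auto
  show ?thesis
    unfolding eq by (subst sum.swap) (intro sum.cong refl, auto)
qed

text \<open>Exchanging the first two values preserves the average, so each cosine may be averaged
  with its exchanged version. The two arguments are A + D and A - D with D = t (a - b) (v x - v y) /
  2, and cos (A + D) + cos (A - D) = 2 cos A cos D. Only the factor cos D depends on the difference
  of the two values.\<close>

lemma cos_pair_avg:
  assumes "finite Q" "card Q \<ge> 2"
  shows "perm_avg Q (\<lambda>xs. cos (t * (c + wsum v (a # b # ws) xs))) =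
    (\<Sum>x\<in>Q. \<Sum>y\<in>Q-{x}. cos (t * (a - b) * (v x - v y) / 2) *
       perm_avg (Q - {x,y}) (\<lambda>xs. cos (t * (c + (a + b) * (v x + v y) / 2 + wsum v ws xs))))
    / (real (card Q) * (real (card Q) - 1))"
proof -
  define g where "g x y = perm_avg (Q - {x,y})
      (\<lambda>xs. cos (t * (c + (a * v x + b * v y) + wsum v ws xs)))" for x y
  define h where "h x y = cos (t * (a - b) * (v x - v y) / 2) *
       perm_avg (Q - {x,y}) (\<lambda>xs. cos (t * (c + (a + b) * (v x + v y) / 2 + wsum v ws xs)))" for x y
  have gh: "g x y + g y x = 2 * h x y" for x y
  proof -
    have swp: "{y,x} = {x,y}" by auto
    have "cos (t * (c + (a * v x + b * v y) + s)) + cos (t * (c + (a * v y + b * v x) + s)) =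
        (2 * cos (t * (a - b) * (v x - v y) / 2)) * cos (t * (c + (a + b) * (v x + v y) / 2 + s))" for s
    proof -
      define A where "A = t * (c + (a + b) * (v x + v y) / 2 + s)"
      define D where "D = t * (a - b) * (v x - v y) / 2"
      have "t * (c + (a * v x + b * v y) + s) = A + D" "t * (c + (a * v y + b * v x) + s) = A - D"
        by (simp_all add: A_def D_def field_simps)
      thus ?thesis unfolding A_def[symmetric] D_def[symmetric]
        by (simp add: cos_add cos_diff)
    qed
    thus ?thesis
      unfolding g_def h_def swp perm_avg_add[symmetric]
      by (simp add: perm_avg_cmult mult.assoc)
  qed
  have "2 * (\<Sum>x\<in>Q. \<Sum>y\<in>Q-{x}. g x y) = (\<Sum>x\<in>Q. \<Sum>y\<in>Q-{x}. g x y + g y x)"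
    using sum_pairs_swap[OF assms(1), of g] by (simp add: sum.distrib)
  also have "\<dots> = 2 * (\<Sum>x\<in>Q. \<Sum>y\<in>Q-{x}. h x y)"
    unfolding gh by (simp add: sum_distrib_left)
  finally have "(\<Sum>x\<in>Q. \<Sum>y\<in>Q-{x}. g x y) = (\<Sum>x\<in>Q. \<Sum>y\<in>Q-{x}. h x y)" by simp
  thus ?thesis
    unfolding g_def h_def using assms by (subst perm_avg_rec2) (simp_all add: algebra_simps)
qed

text \<open>The two members of a pair occupy adjacent positions, so revealing two values at a time
  treats exactly one pair.\<close>

fun flat_pairs :: "('a \<times> 'a) list \<Rightarrow> 'a list" where
  "flat_pairs [] = []"
| "flat_pairs ((a, b) # zs) = a # b # flat_pairs zs"

lemma length_flat_pairs [simp]: "length (flat_pairs zs) = 2 * length zs"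
  by (induction zs rule: flat_pairs.induct) auto

lemma map_flat_pairs: "map f (flat_pairs zs) = flat_pairs (map (map_prod f f) zs)"
  by (induction zs rule: flat_pairs.induct) auto

text \<open>
  Averaging over the exchange of the two values at an adjacent pair of positions turns the cosine
  into a product of cosines, and drawing the pair of values at random makes each factor small on
  average.
\<close>

lemma abs_perm_avg_cos_le:
  assumes "finite Q" "2 * length zs \<le> card Q" "\<gamma> \<ge> 0"
    and "\<And>a b Q'. (a, b) \<in> set zs \<Longrightarrow> Q' \<subseteq> Q \<Longrightarrow> card (Q - Q') \<le> 2 * length zs \<Longrightarrow>
      card Q' \<ge> 2 \<Longrightarrow>
      (\<Sum>x\<in>Q'. \<Sum>y\<in>Q'-{x}. \<bar>cos (t * (a - b) * (v x - v y) / 2)\<bar>)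
        \<le> \<gamma> * (real (card Q') * (real (card Q') - 1))"
  shows "\<bar>perm_avg Q (\<lambda>xs. cos (t * (c + wsum v (flat_pairs zs @ ws) xs)))\<bar> \<le> \<gamma> ^ length zs"
  using assms
proof (induction zs arbitrary: Q c)
  case Nil
  have "perm_avg Q (\<lambda>xs. cos (t * (c + wsum v ws xs))) \<le> perm_avg Q (\<lambda>_. 1)"
    by (intro perm_avg_mono) auto
  moreover have "perm_avg Q (\<lambda>_. - 1) \<le> perm_avg Q (\<lambda>xs. cos (t * (c + wsum v ws xs)))"
    by (intro perm_avg_mono) auto
  ultimately show ?case using Nil by (simp add: abs_le_iff)
next
  case (Cons ab zs)
  obtain a b where ab: "ab = (a, b)" by (cases ab)
  define h where "h x y = perm_avg (Q - {x,y})
      (\<lambda>xs. cos (t * (c + (a + b) * (v x + v y) / 2 + wsum v (flat_pairs zs @ ws) xs)))" for x y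
  have cQ: "card Q \<ge> 2" using Cons.prems by auto
  let ?N = "real (card Q) * (real (card Q) - 1)"
  have N: "?N > 0" using cQ by simp
  have h: "\<bar>h x y\<bar> \<le> \<gamma> ^ length zs" if xy: "x \<in> Q" "y \<in> Q - {x}" for x y
    unfolding h_def
  proof (rule Cons.IH)
    have c2: "card (Q - {x,y}) = card Q - 2"
      using xy Cons.prems(1) by (subst card_Diff_subset) auto
    show "2 * length zs \<le> card (Q - {x,y})" using c2 Cons.prems(2) by simp
    fix a' b' Q' assume *: "(a', b') \<in> set zs" "Q' \<subseteq> Q - {x,y}"
      "card (Q - {x,y} - Q') \<le> 2 * length zs" "card Q' \<ge> 2"
    \<comment> \<open>Removing \<open>x\<close> and \<open>y\<close> uses up the two elements by
      which the allowance \<open>2 * length zs\<close> grows with the additional pair.\<close>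
    have "card (Q - Q') \<le> card ((Q - {x,y} - Q') \<union> {x,y})"
      using Cons.prems(1) by (intro card_mono) auto
    also have "\<dots> \<le> card (Q - {x,y} - Q') + card {x,y}" by (rule card_Un_le)
    also have "card {x,y} \<le> 2" by (rule card_2_iff'[THEN iffD2, THEN eq_imp_le]) (use xy in auto)
    finally have "card (Q - Q') \<le> 2 * length (ab # zs)" using *(3) by simp
    thus "(\<Sum>x\<in>Q'. \<Sum>y\<in>Q'-{x}. \<bar>cos (t * (a' - b') * (v x - v y) / 2)\<bar>)
        \<le> \<gamma> * (real (card Q') * (real (card Q') - 1))"
      using * by (intro Cons.prems(4)) auto
  qed (use Cons.prems in auto)
  have "\<bar>perm_avg Q (\<lambda>xs. cos (t * (c + wsum v (flat_pairs (ab # zs) @ ws) xs)))\<bar> =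
     \<bar>\<Sum>x\<in>Q. \<Sum>y\<in>Q-{x}. cos (t * (a - b) * (v x - v y) / 2) * h x y\<bar> / ?N"
    using Cons.prems(1) cQ N unfolding ab flat_pairs.simps append_Cons h_def by (subst cos_pair_avg) auto
  also have "\<bar>\<Sum>x\<in>Q. \<Sum>y\<in>Q-{x}. cos (t * (a - b) * (v x - v y) / 2) * h x y\<bar>
      \<le> (\<Sum>x\<in>Q. \<Sum>y\<in>Q-{x}. \<bar>cos (t * (a - b) * (v x - v y) / 2)\<bar> * \<bar>h x y\<bar>)"
    unfolding abs_mult[symmetric] by (intro order.trans[OF sum_abs] sum_mono sum_abs)
  also have "\<dots> \<le> (\<Sum>x\<in>Q. \<Sum>y\<in>Q-{x}. \<bar>cos (t * (a - b) * (v x - v y) / 2)\<bar> * \<gamma> ^ length zs)"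
    using h by (intro sum_mono mult_left_mono) auto
  also have "\<dots> = (\<Sum>x\<in>Q. \<Sum>y\<in>Q-{x}. \<bar>cos (t * (a - b) * (v x - v y) / 2)\<bar>) * \<gamma> ^ length zs"
    by (simp add: sum_distrib_right)
  also have "\<dots> \<le> (\<gamma> * ?N) * \<gamma> ^ length zs"
    using Cons.prems(3) cQ by (intro mult_right_mono Cons.prems(4)) (auto simp: ab)
  finally have "\<bar>perm_avg Q (\<lambda>xs. cos (t * (c + wsum v (flat_pairs (ab # zs) @ ws) xs)))\<bar>
      \<le> (\<gamma> * ?N) * \<gamma> ^ length zs / ?N"
    using N by (simp only: divide_right_mono less_imp_le)
  also have "\<dots> = ?N * \<gamma> ^ length (ab # zs) / ?N"
    by (simp only: mult_ac length_Cons power_Suc)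
  also have "\<dots> = \<gamma> ^ length (ab # zs)"
    by (rule nonzero_mult_div_cancel_left[OF less_imp_neq[OF N, symmetric]])
  finally show ?case .
qed

section \<open>Smoothing\<close>

text \<open>Integration by parts. What matters is that the value is never negative: it is half the
  Fourier transform of the tent function 1 - |t| on [-1, 1].\<close>

lemma integral_tent_cos:
  "integral {0..1} (\<lambda>t::real. (1 - t) * cos (t * x)) =
     (if x = 0 then 1/2 else (1 - cos x) / x\<^sup>2)"
proof (cases "x = 0")
  case True
  have "((\<lambda>t::real. (1 - t) * cos (t * x)) has_integral
     (1 - 1\<^sup>2/2) - (0 - 0\<^sup>2/2)) {0..1}"
    by (rule fundamental_theorem_of_calculus)
       (auto intro!: derivative_eq_intros simp: True has_real_derivative_iff_has_vector_derivative[symmetric])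
  thus ?thesis using True by (simp add: integral_unique)
next
  case False
  have "((\<lambda>t::real. (1 - t) * cos (t * x)) has_integral
     ((1 - 1) * sin (1 * x) / x - cos (1 * x) / x\<^sup>2)
     - ((1 - 0) * sin (0 * x) / x - cos (0 * x) / x\<^sup>2)) {0..1}"
    by (rule fundamental_theorem_of_calculus)
       (use False in \<open>auto intro!: derivative_eq_intros
          simp: has_real_derivative_iff_has_vector_derivative[symmetric] field_simps power2_eq_square\<close>)
  thus ?thesis using False by (simp add: integral_unique field_simps)
qed

text \<open>Outside the unit interval nonnegativity suffices. Inside, 1 \<le> pi / 3 gives cos (t x)
  \<ge> 1/2, so the integral is at least 1/4, whence the factor 4.\<close>

lemma of_bool_le_integral_tent_cos:
  "of_bool (\<bar>x\<bar> \<le> 1) \<le> 4 * integral {0..1} (\<lambda>t::real. (1 - t) * cos (t * x))"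
proof (cases "\<bar>x\<bar> \<le> 1")
  case False
  thus ?thesis by (auto simp: integral_tent_cos)
next
  case True
  have "((\<lambda>t::real. (1 - t) * (1/2)) has_integral
     (1/2 - 1\<^sup>2/4) - (0/2 - 0\<^sup>2/4)) {0..1}"
    by (rule fundamental_theorem_of_calculus)
       (auto intro!: derivative_eq_intros simp: has_real_derivative_iff_has_vector_derivative[symmetric])
  from integral_unique[OF this]
  have "1/4 = integral {0..1} (\<lambda>t::real. (1 - t) * (1/2))" by (simp only:) (simp add: power2_eq_square)
  also have "\<dots> \<le> integral {0..1} (\<lambda>t::real. (1 - t) * cos (t * x))"
  proof (rule integral_le)
    fix t :: real assume t: "t \<in> {0..1}"
    have "\<bar>t * x\<bar> \<le> 1" using t True by (auto simp: abs_mult mult_le_one)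
    moreover have "1 \<le> pi / 3" using pi_gt3 by simp
    ultimately have "cos (pi / 3) \<le> cos \<bar>t * x\<bar>"
      using pi_gt3 by (subst cos_mono_le_eq) auto
    hence "1/2 \<le> cos (t * x)" by (simp add: cos_60)
    thus "(1 - t) * (1/2) \<le> (1 - t) * cos (t * x)"
      using t by (intro mult_left_mono) auto
  qed (auto intro!: integrable_continuous_real continuous_intros)
  finally show ?thesis using True by simp
qed

text \<open>The tent bound is applied to \<open>X xs / r\<close>, and the finite average is
  exchanged with the integral. The weight 1 - t is then dropped, since \<open>h\<close> dominates an
  absolute value and hence is nonnegative.\<close>

lemma perm_avg_small_ball_le:
  fixes X :: "'a list \<Rightarrow> real"
  assumes r: "r > 0" and cont: "h integrable_on {0..1}"
    and le: "\<And>t. t \<in> {0..1} \<Longrightarrow> \<bar>perm_avg Q (\<lambda>xs. cos (t / r * X xs))\<bar> \<le> h t"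
  shows "perm_avg Q (\<lambda>xs. of_bool (\<bar>X xs\<bar> \<le> r)) \<le> 4 * integral {0..1} h"
proof -
  have "perm_avg Q (\<lambda>xs. of_bool (\<bar>X xs\<bar> \<le> r)) \<le>
      perm_avg Q (\<lambda>xs. 4 * integral {0..1} (\<lambda>t::real. (1 - t) * cos (t * (X xs / r))))"
  proof (rule perm_avg_mono)
    fix xs show "of_bool (\<bar>X xs\<bar> \<le> r) \<le> 4 * integral {0..1} (\<lambda>t::real. (1 - t) * cos (t * (X xs / r)))"
      using of_bool_le_integral_tent_cos[of "X xs / r"] r by simp
  qed
  also have "\<dots> = 4 * integral {0..1} (\<lambda>t. (1 - t) * perm_avg Q (\<lambda>xs. cos (t / r * X xs)))"
  proof -
    have "integral {0..1} (\<lambda>t. (1 - t) * perm_avg Q (\<lambda>xs. cos (t / r * X xs))) =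
      integral {0..1} (\<lambda>t. (\<Sum>xs\<in>permutations_of_set Q. (1 - t) * cos (t * (X xs / r))) * (1 / fact (card Q)))"
      by (simp add: perm_avg_def sum_distrib_left)
    also have "\<dots> = integral {0..1} (\<lambda>t. (\<Sum>xs\<in>permutations_of_set Q. (1 - t) * cos (t * (X xs / r)))) * (1 / fact (card Q))"
      by (rule integral_mult_left)
    also have "integral {0..1} (\<lambda>t. (\<Sum>xs\<in>permutations_of_set Q. (1 - t) * cos (t * (X xs / r)))) =
       (\<Sum>xs\<in>permutations_of_set Q. integral {0..1} (\<lambda>t. (1 - t) * cos (t * (X xs / r))))"
      by (intro integral_sum integrable_continuous_real continuous_intros) auto
    finally show ?thesis by (simp add: perm_avg_def sum_distrib_left)
  qed
  also have "\<dots> \<le> 4 * integral {0..1} h"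
  proof (intro mult_left_mono integral_le cont)
    fix t :: real assume t: "t \<in> {0..1}"
    have "(1 - t) * perm_avg Q (\<lambda>xs. cos (t / r * X xs)) \<le> (1 - t) * h t"
      using le[OF t] t by (intro mult_left_mono) auto
    also have "\<dots> \<le> 1 * h t"
      using le[OF t] t by (intro mult_right_mono) auto
    finally show "(1 - t) * perm_avg Q (\<lambda>xs. cos (t / r * X xs)) \<le> h t" by simp
  next
    show "(\<lambda>t. (1 - t) * perm_avg Q (\<lambda>xs. cos (t / r * X xs))) integrable_on {0..1}"
      unfolding perm_avg_def using r
      by (intro integrable_continuous_real continuous_intros) auto
  qed auto
  finally show ?thesis .
qed

lemma integral_inverse_quadratic_le:
  assumes "a > 0"
  shows "(\<lambda>t::real. 1 / (1 + (a * t)\<^sup>2)) integrable_on {0..1}"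
    and "integral {0..1} (\<lambda>t::real. 1 / (1 + (a * t)\<^sup>2)) \<le> 2 / a"
proof -
  have *: "((\<lambda>t::real. 1 / (1 + (a * t)\<^sup>2)) has_integral arctan (a * 1) / a - arctan (a * 0) / a) {0..1}"
    by (rule fundamental_theorem_of_calculus)
       (use assms in \<open>auto intro!: derivative_eq_intros
          simp: has_real_derivative_iff_has_vector_derivative[symmetric] inverse_eq_divide\<close>)
  show "(\<lambda>t::real. 1 / (1 + (a * t)\<^sup>2)) integrable_on {0..1}" using * by blast
  have "arctan a \<le> 2" using arctan_ubound[of a] pi_less_4 by linarith
  thus "integral {0..1} (\<lambda>t::real. 1 / (1 + (a * t)\<^sup>2)) \<le> 2 / a"
    using integral_unique[OF *] assms by (simp add: divide_right_mono)
qed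

section \<open>Sines on dense subsets of an interval\<close>

lemma card_le_of_diam:
  fixes S :: "nat set"
  assumes "finite S" "D \<ge> 0" "\<And>x y. x \<in> S \<Longrightarrow> y \<in> S \<Longrightarrow> \<bar>real x - real y\<bar> \<le> D"
  shows "real (card S) \<le> D + 1"
proof (cases "S = {}")
  case False
  have "S \<subseteq> {Min S..Max S}" using assms(1) by auto
  hence "card S \<le> Suc (Max S) - Min S" using card_mono[of "{Min S..Max S}" S] by simp
  moreover have "Min S \<le> Max S" using False assms(1) by simp
  moreover have "real (Max S) - real (Min S) \<le> D"
    using assms(3)[of "Max S" "Min S"] False assms(1) by auto
  ultimately show ?thesis by linarith
qed (use assms in auto)

text \<open>There are at most n / l + 1 blocks, and \<open>l \<le> n\<close> absorbs the additional
  one into 2 n / l.\<close>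

lemma card_le_blocks:
  fixes S :: "nat set" and l n :: nat
  assumes S: "S \<subseteq> {1..n}" and l: "0 < l" "l \<le> n" and C: "C \<ge> 0"
    and block: "\<And>b. real (card {x\<in>S. x div l = b}) \<le> C"
  shows "real (card S) \<le> 2 * n / l * C"
proof -
  have "S \<subseteq> (\<Union>b\<in>{..n div l}. {x\<in>S. x div l = b})"
    using S by (auto intro!: div_le_mono)
  moreover have "finite S" using S finite_subset by blast
  ultimately have "card S \<le> (\<Sum>b\<le>n div l. card {x\<in>S. x div l = b})"
    by (intro order.trans[OF card_mono card_UN_le]) auto
  hence "real (card S) \<le> (\<Sum>b\<le>n div l. real (card {x\<in>S. x div l = b}))"
    by (metis of_nat_le_iff of_nat_sum)
  also have "\<dots> \<le> (\<Sum>b\<le>n div l. C)" by (intro sum_mono block)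
  also have "\<dots> = (real (n div l) + 1) * C" by simp
  also have "\<dots> \<le> (2 * n / l) * C"
  proof (intro mult_right_mono C)
    have "real (n div l) \<le> n / l" by (rule of_nat_div_le_of_nat)
    moreover have "1 \<le> real n / l" using l by simp
    ultimately show "real (n div l) + 1 \<le> 2 * n / l" by simp
  qed
  finally show ?thesis .
qed

lemma half_le_sin:
  fixes x :: real
  assumes "0 \<le> x" "x \<le> 1" shows "x / 2 \<le> sin x"
proof -
  have "\<bar>sin x - (\<Sum>m<3. sin_coeff m * x ^ m)\<bar> \<le> inverse (fact 3) * \<bar>x\<bar> ^ 3"
    by (rule Maclaurin_sin_bound)
  moreover have "(\<Sum>m<3. sin_coeff m * x ^ m) = x"
    by (simp add: eval_nat_numeral sin_coeff_def)
  moreover have "inverse (fact 3) * \<bar>x\<bar> ^ 3 \<le> 1/2 * x"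
    using assms mult_le_one[of x x] mult_left_mono[of "x * x" 1 x]
    by (simp add: eval_nat_numeral)
  ultimately show ?thesis by linarith
qed

text \<open>
  Within a block of length at most \<open>1 / \<theta>\<close> the map \<open>y \<mapsto> \<theta> y\<close> covers less than one
  radian, so all bad \<open>y\<close> of a block are close to each other.
\<close>

lemma card_small_sin_le:
  fixes \<theta> \<tau> x :: real and l n :: nat
  assumes l: "0 < l" "l \<le> n" and th: "\<theta> > 0" "\<theta> * real l \<le> 1" and tau: "\<tau> \<ge> 0"
  shows "real (card {y\<in>{1..n}. \<bar>sin (\<theta> * (x - real y))\<bar> < \<tau>}) \<le> 2 * n / l * (4 * \<tau> / \<theta> + 1)"
proof (rule card_le_blocks[OF _ l])
  fix b
  let ?S = "{y \<in> {y\<in>{1..n}. \<bar>sin (\<theta> * (x - real y))\<bar> < \<tau>}. y div l = b}"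
  show "real (card ?S) \<le> 4 * \<tau> / \<theta> + 1"
  proof (rule card_le_of_diam)
    fix y z assume y: "y \<in> ?S" and z: "z \<in> ?S"
    define d where "d = \<bar>real y - real z\<bar>"
    have "y < l * b + l" "l * b \<le> y" "z < l * b + l" "l * b \<le> z"
      using y z dividend_less_times_div[OF l(1), of y] dividend_less_times_div[OF l(1), of z]
        times_div_less_eq_dividend[of l y] times_div_less_eq_dividend[of l z]
      by (auto simp: add.commute)
    hence "d \<le> real l" unfolding d_def by linarith
    hence "\<theta> * d \<le> \<theta> * real l" using th by (intro mult_left_mono) auto
    hence d1: "\<theta> * d \<le> 1" using th(2) by linarith
    have d0: "0 \<le> \<theta> * d" using th(1) by (simp add: d_def)
    \<comment> \<open>For two bad points of one block, sin (\<theta> d) is at least \<theta> d / 2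
      and, by the subtraction formula, at most 2 \<tau>. Hence d \<le> 4 \<tau> / \<theta>.\<close>
    have "\<theta> * d / 2 \<le> sin (\<theta> * d)" by (rule half_le_sin[OF d0 d1])
    also have "\<dots> \<le> \<bar>sin (\<theta> * (x - real z) - \<theta> * (x - real y))\<bar>"
    proof (cases "y \<ge> z")
      case True
      hence "\<theta> * (x - real z) - \<theta> * (x - real y) = \<theta> * d" by (simp add: d_def algebra_simps)
      thus ?thesis by simp
    next
      case False
      hence "\<theta> * (x - real z) - \<theta> * (x - real y) = - (\<theta> * d)" by (simp add: d_def algebra_simps)
      thus ?thesis by (simp only: sin_minus abs_minus_cancel abs_ge_self)
    qed
    also have "\<dots> \<le> \<bar>sin (\<theta> * (x - real z))\<bar> * \<bar>cos (\<theta> * (x - real y))\<bar>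
        + \<bar>cos (\<theta> * (x - real z))\<bar> * \<bar>sin (\<theta> * (x - real y))\<bar>"
      unfolding sin_diff abs_mult[symmetric] by (rule abs_triangle_ineq4)
    also have "\<dots> \<le> \<bar>sin (\<theta> * (x - real z))\<bar> * 1 + 1 * \<bar>sin (\<theta> * (x - real y))\<bar>"
      by (intro add_mono mult_left_mono mult_right_mono) auto
    also have "\<dots> \<le> 2 * \<tau>" using y z by simp
    finally show "\<bar>real y - real z\<bar> \<le> 4 * \<tau> / \<theta>"
      unfolding d_def[symmetric] using th by (simp add: field_simps)
  qed (use tau th in auto)
qed (use tau th in auto)

text \<open>Blocks must be short enough that \<open>\<theta> * l\<close> stays within one radian,
  yet long enough that the rounding error of one point per block is negligible. The whole range
  serves if n \<theta> \<le> 1; otherwise l is the integer part of 1 / \<theta>, so that \<theta> l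
  \<ge> 1 - \<theta> \<ge> 1/2.\<close>

lemma exists_block_length:
  fixes \<theta> \<kappa> :: real and n :: nat
  assumes "0 < \<kappa>" "\<kappa> \<le> 1" "8 / \<kappa> \<le> real n" "0 < \<theta>" "\<theta> \<le> \<kappa> / 16"
  obtains l where "l \<le> n" "8 / \<kappa> \<le> real l" "\<theta> * real l \<le> 1" "min (real n * \<theta>) (1/2) \<le> \<theta> * real l"
proof (cases "real n * \<theta> \<le> 1")
  case True
  show ?thesis by (rule that[of n]) (use assms True in \<open>auto simp: mult.commute\<close>)
next
  case False
  define l where "l = nat \<lfloor>1 / \<theta>\<rfloor>"
  have "16 / \<kappa> \<le> 1 / \<theta>" using assms by (simp add: field_simps)
  moreover have "8 / \<kappa> \<ge> 8" "16 / \<kappa> = 8 / \<kappa> + 8 / \<kappa>" using assms by (simp_all add: field_simps)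
  ultimately have l1: "8 / \<kappa> \<le> 1 / \<theta> - 1" by linarith
  have "1 / \<theta> > 0" using assms by simp
  hence l: "real l \<le> 1 / \<theta>" "1 / \<theta> - 1 \<le> real l" unfolding l_def by linarith+
  have tl: "\<theta> * real l \<le> 1" using l(1) assms by (simp add: field_simps)
  hence "\<theta> * real l \<le> \<theta> * real n" using False by (simp add: mult.commute)
  hence "real l \<le> real n" using assms by simp
  moreover note tl
  moreover have "1/2 \<le> \<theta> * real l"
  proof -
    have "\<theta> * (1 / \<theta> - 1) \<le> \<theta> * real l" using l assms by (intro mult_left_mono) auto
    moreover have "\<theta> * (1 / \<theta> - 1) = 1 - \<theta>" using assms by (simp add: field_simps)
    ultimately show ?thesis using assms by linarith
  qed
  ultimately show ?thesis using l l1 by (intro that[of l]) auto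
qed

text \<open>For every fixed \<open>x\<close> at most half of the guaranteed size \<kappa> n of
  \<open>J\<close> consists of points \<open>y\<close> whose sine is below a threshold \<tau>; the
  remaining ones contribute at least \<tau>^2 each.\<close>

lemma sum_sin_squared_ge:
  fixes \<theta> \<kappa> :: real and n :: nat
  assumes k: "0 < \<kappa>" "\<kappa> \<le> 1" and n: "8 / \<kappa> \<le> real n" and th: "0 < \<theta>" "\<theta> \<le> \<kappa> / 16"
    and J: "J \<subseteq> {1..n}" "\<kappa> * real n \<le> real (card J)"
  shows "\<kappa>\<^sup>2 / 2 * (\<kappa> / 32)\<^sup>2 * (min (real n * \<theta>) (1/2))\<^sup>2 * (real n)\<^sup>2
    \<le> (\<Sum>x\<in>J. \<Sum>y\<in>J. (sin (\<theta> * (real x - real y)))\<^sup>2)"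
proof -
  obtain l where l: "l \<le> n" "8 / \<kappa> \<le> real l" "\<theta> * real l \<le> 1"
      "min (real n * \<theta>) (1/2) \<le> \<theta> * real l"
    using exists_block_length[OF k n th] by blast
  have fin: "finite J" using J finite_subset by blast
  have l0: "0 < l" using l(2) k by (cases l) (auto simp: divide_le_0_iff)
  \<comment> \<open>With this threshold the number of bad points is at most n (\<kappa> / 4 + 2 /
    l), and l \<ge> 8 / \<kappa> makes this at most \<kappa> n / 2.\<close>
  define \<tau> where "\<tau> = \<kappa> / 32 * (\<theta> * real l)"
  have tau: "\<tau> \<ge> 0" using k th by (simp add: \<tau>_def)
  have inner: "\<kappa> / 2 * real n * \<tau>\<^sup>2 \<le> (\<Sum>y\<in>J. (sin (\<theta> * (x - real y)))\<^sup>2)" for x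
  proof -
    let ?B = "{y\<in>{1..n}. \<bar>sin (\<theta> * (x - real y))\<bar> < \<tau>}"
    have "real (card ?B) \<le> 2 * n / l * (4 * \<tau> / \<theta> + 1)"
      by (rule card_small_sin_le[OF l0 l(1) th(1) l(3) tau])
    also have "\<dots> = n * (\<kappa> / 4 + 2 / l)"
      using th l0 by (simp add: \<tau>_def field_simps)
    also have "\<dots> \<le> n * (\<kappa> / 4 + \<kappa> / 4)"
      using l(2) k l0 by (intro mult_left_mono add_left_mono) (auto simp: field_simps)
    also have "\<dots> = \<kappa> / 2 * n" by simp
    finally have B: "real (card ?B) \<le> \<kappa> / 2 * n" .
    have "card J \<le> card (J - ?B) + card ?B"
    proof -
      have "card J \<le> card ((J - ?B) \<union> ?B)" using fin by (intro card_mono) auto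
      also have "\<dots> \<le> card (J - ?B) + card ?B" by (rule card_Un_le)
      finally show ?thesis .
    qed
    hence "\<kappa> / 2 * n \<le> real (card (J - ?B))" using B J(2) by linarith
    hence "\<kappa> / 2 * n * \<tau>\<^sup>2 \<le> real (card (J - ?B)) * \<tau>\<^sup>2" by (intro mult_right_mono) auto
    hence "\<kappa> / 2 * n * \<tau>\<^sup>2 \<le> (\<Sum>y\<in>J-?B. \<tau>\<^sup>2)" by simp
    also have "\<dots> \<le> (\<Sum>y\<in>J-?B. (sin (\<theta> * (x - real y)))\<^sup>2)"
      using J(1) tau by (intro sum_mono abs_le_square_iff[THEN iffD1]) auto
    also have "\<dots> \<le> (\<Sum>y\<in>J. (sin (\<theta> * (x - real y)))\<^sup>2)"
      using fin by (intro sum_mono2) auto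
    finally show ?thesis .
  qed
  have "\<kappa>\<^sup>2 / 2 * (\<kappa> / 32)\<^sup>2 * (min (real n * \<theta>) (1/2))\<^sup>2 * (real n)\<^sup>2
     \<le> \<kappa>\<^sup>2 / 2 * (\<kappa> / 32)\<^sup>2 * (\<theta> * real l)\<^sup>2 * (real n)\<^sup>2"
    using l(4) k th by (intro mult_left_mono mult_right_mono power_mono) auto
  also have "\<dots> = (\<kappa> * n) * (\<kappa> / 2 * real n * \<tau>\<^sup>2)"
    by (simp add: \<tau>_def field_simps power2_eq_square)
  also have "\<dots> \<le> real (card J) * (\<kappa> / 2 * real n * \<tau>\<^sup>2)"
    using J(2) k by (intro mult_right_mono) auto
  also have "\<dots> = (\<Sum>x\<in>J. \<kappa> / 2 * real n * \<tau>\<^sup>2)" by simp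
  also have "\<dots> \<le> (\<Sum>x\<in>J. \<Sum>y\<in>J. (sin (\<theta> * (real x - real y)))\<^sup>2)"
    by (intro sum_mono inner)
  finally show ?thesis .
qed

section \<open>Averages of cosines over pairs of values\<close>

lemma abs_cos_le: "\<bar>cos x\<bar> \<le> 1 - (sin x)\<^sup>2 / 2" for x :: real
proof -
  have "0 \<le> (1 - \<bar>cos x\<bar>)\<^sup>2" by simp
  also have "\<dots> = 1 - 2 * \<bar>cos x\<bar> + (cos x)\<^sup>2" by (simp add: power2_eq_square algebra_simps)
  finally show ?thesis unfolding sin_squared_eq by argo
qed

text \<open>Supplies the factor required for one pair of positions. On \<open>J\<close> the
  differences of values are (x - y) / n, so the sine estimate applies with \<theta> = |u| / n; the
  other pairs of \<open>Q\<close> contribute nonnegative squares. Since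
  \<open>card Q \<le> n\<close>, the total deficit is a proportion c of all pairs, and 1 - c \<le>
  exp (- c).\<close>

lemma sum_abs_cos_le:
  fixes \<kappa> u :: real and v :: "nat \<Rightarrow> real"
  assumes k: "0 < \<kappa>" "\<kappa> \<le> 1" and n: "8 / \<kappa> \<le> real n" and th: "0 < \<bar>u\<bar>" "\<bar>u\<bar> \<le> \<kappa> / 16 * real n"
    and Q: "Q \<subseteq> {1..n}" "card Q \<ge> 2" and J: "J \<subseteq> Q" "\<kappa> * real n \<le> real (card J)"
    and v: "\<And>i. i \<in> J \<Longrightarrow> v i = real i / real n"
  shows "(\<Sum>x\<in>Q. \<Sum>y\<in>Q-{x}. \<bar>cos (u * (v x - v y))\<bar>)
    \<le> exp (- (\<kappa>\<^sup>2 / 4 * (\<kappa> / 32)\<^sup>2 * (min \<bar>u\<bar> (1/2))\<^sup>2)) * (real (card Q) * (real (card Q) - 1))"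
proof -
  define c where "c = \<kappa>\<^sup>2 / 4 * (\<kappa> / 32)\<^sup>2 * (min \<bar>u\<bar> (1/2))\<^sup>2"
  have c: "c \<ge> 0" by (simp add: c_def)
  have fin: "finite Q" using Q finite_subset by blast
  have finJ: "finite J" using fin J finite_subset by blast
  have "0 < 8 / \<kappa>" using k by simp
  hence n0: "real n > 0" using n by linarith
  let ?N = "real (card Q) * (real (card Q) - 1)"
  define s where "s x y = (sin (u * (v x - v y)))\<^sup>2" for x y
  have "2 * c * (real n)\<^sup>2 \<le> (\<Sum>x\<in>J. \<Sum>y\<in>J. (sin (\<bar>u\<bar> / n * (real x - real y)))\<^sup>2)"
  proof -
    have "\<kappa>\<^sup>2 / 2 * (\<kappa> / 32)\<^sup>2 * (min (real n * (\<bar>u\<bar> / n)) (1/2))\<^sup>2 * (real n)\<^sup>2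
      \<le> (\<Sum>x\<in>J. \<Sum>y\<in>J. (sin (\<bar>u\<bar> / n * (real x - real y)))\<^sup>2)"
      using k n th J Q n0 by (intro sum_sin_squared_ge) (auto simp: field_simps)
    moreover have "real n * (\<bar>u\<bar> / n) = \<bar>u\<bar>" using n0 by simp
    ultimately show ?thesis by (simp add: c_def mult_ac)
  qed
  also have "\<dots> = (\<Sum>x\<in>J. \<Sum>y\<in>J. s x y)"
  proof (intro sum.cong refl)
    fix x y assume "x \<in> J" "y \<in> J"
    hence *: "u * (v x - v y) = u / n * (real x - real y)" by (simp add: v diff_divide_distrib[symmetric])
    show "(sin (\<bar>u\<bar> / n * (real x - real y)))\<^sup>2 = s x y"
      unfolding s_def * by (cases "u \<ge> 0") simp_all
  qed
  also have "\<dots> = (\<Sum>x\<in>J. \<Sum>y\<in>J-{x}. s x y)"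
    using finJ by (intro sum.cong refl sum.mono_neutral_right) (auto simp: s_def)
  also have "\<dots> \<le> (\<Sum>x\<in>J. \<Sum>y\<in>Q-{x}. s x y)"
    using fin J by (intro sum_mono sum_mono2) (auto simp: s_def)
  also have "\<dots> \<le> (\<Sum>x\<in>Q. \<Sum>y\<in>Q-{x}. s x y)"
    using fin J by (intro sum_mono2) (auto simp: s_def intro!: sum_nonneg)
  finally have S: "2 * c * (real n)\<^sup>2 \<le> (\<Sum>x\<in>Q. \<Sum>y\<in>Q-{x}. s x y)" .
  have cn: "card Q \<le> n" using card_mono[OF _ Q(1)] by simp
  have "?N \<le> real n * real n" using cn Q(2) by (intro mult_mono) auto
  hence "c * ?N \<le> c * (real n)\<^sup>2" using c by (intro mult_left_mono) (simp_all add: power2_eq_square)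
  also have "\<dots> \<le> (\<Sum>x\<in>Q. \<Sum>y\<in>Q-{x}. s x y / 2)"
    using S by (simp add: sum_divide_distrib[symmetric])
  finally have S': "c * ?N \<le> (\<Sum>x\<in>Q. \<Sum>y\<in>Q-{x}. s x y / 2)" .
  have one: "(\<Sum>x\<in>Q. \<Sum>y\<in>Q-{x}. 1) = ?N"
    using Q by (simp add: of_nat_diff)
  have "(\<Sum>x\<in>Q. \<Sum>y\<in>Q-{x}. \<bar>cos (u * (v x - v y))\<bar>) \<le> (\<Sum>x\<in>Q. \<Sum>y\<in>Q-{x}. 1 - s x y / 2)"
    unfolding s_def by (intro sum_mono abs_cos_le)
  also have "\<dots> = ?N - (\<Sum>x\<in>Q. \<Sum>y\<in>Q-{x}. s x y / 2)"
    by (simp only: sum_subtractf one)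
  also have "\<dots> \<le> (1 - c) * ?N" using S' by (simp add: algebra_simps)
  also have "\<dots> \<le> exp (- c) * ?N"
    using Q(2) exp_ge_add_one_self[of "-c"] by (intro mult_right_mono) auto
  finally show ?thesis unfolding c_def .
qed

section \<open>The small ball estimate\<close>

text \<open>Greedy selection: the positions already used form an admissible set \<open>X\<close>,
  outside which a further pair exists.\<close>

lemma exists_disjoint_pairs:
  assumes "\<And>X. X \<subseteq> P \<Longrightarrow> card X \<le> 2 * k \<Longrightarrow> finite X \<Longrightarrow> \<exists>a\<in>P-X. \<exists>b\<in>P-X. a \<noteq> b \<and> R a b"
  shows "\<exists>zs. length zs = k \<and> distinct (flat_pairs zs) \<and> set (flat_pairs zs) \<subseteq> P \<and>
    (\<forall>(a, b)\<in>set zs. R a b)"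
  using assms
proof (induction k)
  case 0
  show ?case by (rule exI[of _ "[]"]) auto
next
  case (Suc k)
  have "\<exists>zs. length zs = k \<and> distinct (flat_pairs zs) \<and> set (flat_pairs zs) \<subseteq> P \<and>
    (\<forall>(a, b)\<in>set zs. R a b)"
    by (rule Suc.IH) (use Suc.prems in auto)
  then obtain zs where zs: "length zs = k" "distinct (flat_pairs zs)" "set (flat_pairs zs) \<subseteq> P"
    "\<forall>(a, b)\<in>set zs. R a b" by blast
  have "card (set (flat_pairs zs)) \<le> 2 * Suc k"
    using card_length[of "flat_pairs zs"] zs(1) by simp
  from Suc.prems[OF zs(3) this] obtain a b where
    "a \<in> P - set (flat_pairs zs)" "b \<in> P - set (flat_pairs zs)" "a \<noteq> b" "R a b" by auto
  thus ?case using zs by (intro exI[of _ "(a, b) # zs"]) auto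
qed

text \<open>Since the squares sum to 1, few weights exceed 2 / (\<epsilon> sqrt n) in absolute
  value. After these and \<open>X\<close> are discarded, more than (1 - \<epsilon>) n indices
  remain, too many for an interval of length \<epsilon> / sqrt n that starts at their minimum. The
  minimum and a weight beyond that interval form the pair.\<close>

lemma weights_ok_wide_pair:
  assumes eps: "0 < \<epsilon>" "\<epsilon> < 1/2" and w: "weights_ok \<epsilon> A n w" and n: "n > 0"
    and X: "X \<subseteq> {1..n}" "real (card X) \<le> \<epsilon> / 2 * real n"
  shows "\<exists>a\<in>{1..n}-X. \<exists>b\<in>{1..n}-X. a \<noteq> b \<and> \<epsilon> / sqrt n \<le> \<bar>w a - w b\<bar> \<and>
    \<bar>w a - w b\<bar> \<le> 4 / \<epsilon> / sqrt n"
proof -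
  define G where "G = {i\<in>{1..n}. \<bar>w i\<bar> > 2 / (\<epsilon> * sqrt n)}"
  have "real (card G) * (2 / (\<epsilon> * sqrt n))\<^sup>2 = (\<Sum>i\<in>G. (2 / (\<epsilon> * sqrt n))\<^sup>2)" by simp
  also have "\<dots> \<le> (\<Sum>i\<in>G. (w i)\<^sup>2)"
    using eps by (intro sum_mono abs_le_square_iff[THEN iffD1]) (auto simp: G_def)
  also have "\<dots> \<le> (\<Sum>i=1..n. (w i)\<^sup>2)" by (intro sum_mono2) (auto simp: G_def)
  also have "\<dots> = 1" using w by (simp add: weights_ok_def)
  finally have "real (card G) \<le> \<epsilon> * (\<epsilon> * n) / 4"
    using eps n by (simp add: power_divide power_mult_distrib field_simps power2_eq_square)
  also have "\<dots> \<le> 1/2 * (\<epsilon> * n) / 4"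
    using eps by (intro divide_right_mono mult_right_mono) auto
  finally have G: "real (card G) \<le> \<epsilon> * n / 8" by simp
  define R where "R = {1..n} - X - G"
  have "n = card {1..n}" by simp
  also have "\<dots> \<le> card (R \<union> (X \<union> G))"
    using X by (intro card_mono) (auto simp: R_def G_def intro: finite_subset)
  also have "\<dots> \<le> card R + (card X + card G)"
    by (intro order.trans[OF card_Un_le] add_left_mono card_Un_le)
  finally have "real n \<le> real (card R) + (real (card X) + real (card G))" by linarith
  \<comment> \<open>The loss is \<epsilon> n / 2 for \<open>X\<close> plus \<epsilon> n / 8 for
    \<open>G\<close>, strictly less than \<epsilon> n.\<close>
  hence "real n - 5/8 * (\<epsilon> * n) \<le> real (card R)" using G X(2) by simp
  moreover have "\<epsilon> * n > 0" using eps n by simp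
  ultimately have R: "(1 - \<epsilon>) * real n < real (card R)" by (simp add: algebra_simps)
  have "0 \<le> (1 - \<epsilon>) * real n" using eps by simp
  hence ne: "R \<noteq> {}" using R by auto
  have fin: "finite R" by (simp add: R_def)
  obtain a where a: "a \<in> R" "\<forall>b\<in>R. w a \<le> w b"
    using ex_min_if_finite[of "w ` R"] fin ne by (auto simp: not_less)
  have "\<exists>b\<in>R. \<not> w b \<le> w a + \<epsilon> / sqrt n"
  proof (rule ccontr)
    assume "\<not> ?thesis"
    hence "card R \<le> card {i\<in>{1..n}. w i \<in> {w a..w a + \<epsilon> / sqrt n}}"
      using a by (intro card_mono) (auto simp: R_def)
    moreover have "real (card {i\<in>{1..n}. w i \<in> {w a..w a + \<epsilon> / sqrt n}}) \<le> (1 - \<epsilon>) * real n"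
      using w unfolding weights_ok_def by blast
    ultimately show False using R by linarith
  qed
  then obtain b where b: "b \<in> R" "w b > w a + \<epsilon> / sqrt n" by auto
  have "\<bar>w a\<bar> \<le> 2 / (\<epsilon> * sqrt n)" "\<bar>w b\<bar> \<le> 2 / (\<epsilon> * sqrt n)"
    using a b by (auto simp: R_def G_def)
  moreover have "4 / \<epsilon> / sqrt n = 2 / (\<epsilon> * sqrt n) + 2 / (\<epsilon> * sqrt n)" by simp
  moreover have "\<epsilon> / sqrt n > 0" using eps n by simp
  ultimately show ?thesis
    using a b by (intro bexI[of _ a] bexI[of _ b]) (auto simp: R_def)
qed

text \<open>The surplus \<open>2 * length zs\<close> in the size of \<open>J\<close> ensures that
  \<kappa> n grid values are still available when the last pair is treated. The upper bound on
  \<open>t\<close> keeps every frequency in the range of the sine estimate, and \<alpha> bounds it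
  below.\<close>

lemma abs_perm_avg_cos_le_exp:
  fixes v :: "nat \<Rightarrow> real"
  assumes k: "0 < \<kappa>" "\<kappa> \<le> 1" and n: "8 / \<kappa> \<le> real n"
    and Q: "Q \<subseteq> {1..n}" and J: "J \<subseteq> Q" "\<kappa> * real n + 2 * real (length zs) \<le> real (card J)"
    and v: "\<And>i. i \<in> J \<Longrightarrow> v i = real i / real n"
    and zs: "\<And>a b. (a, b) \<in> set zs \<Longrightarrow> \<alpha> \<le> \<bar>a - b\<bar> \<and> \<bar>a - b\<bar> \<le> \<beta>"
    and pos: "0 < \<alpha>" "0 < t" and t: "t * \<beta> / 2 \<le> \<kappa> / 16 * real n"
  shows "\<bar>perm_avg Q (\<lambda>xs. cos (t * (c + wsum v (flat_pairs zs @ ws) xs)))\<bar>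
    \<le> exp (- (\<kappa>\<^sup>2 / 4 * (\<kappa> / 32)\<^sup>2 * (min (t * \<alpha> / 2) (1/2))\<^sup>2)) ^ length zs"
proof (rule abs_perm_avg_cos_le)
  show fin: "finite Q" using Q finite_subset by blast
  have "card J \<le> card Q" using J fin by (intro card_mono) auto
  moreover have "0 \<le> \<kappa> * real n" using k by simp
  ultimately show "2 * length zs \<le> card Q" using J(2) by linarith
  fix a b Q' assume ab: "(a, b) \<in> set zs" and Q': "Q' \<subseteq> Q" "card (Q - Q') \<le> 2 * length zs" "card Q' \<ge> 2"
  have finJ: "finite J" using fin J finite_subset by blast
  have "card J \<le> card (J \<inter> Q' \<union> (Q - Q'))" using J fin finJ by (intro card_mono) auto
  also have "\<dots> \<le> card (J \<inter> Q') + card (Q - Q')" by (rule card_Un_le)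
  finally have J': "\<kappa> * real n \<le> real (card (J \<inter> Q'))" using Q'(2) J(2) by linarith
  define u where "u = t * (a - b) / 2"
  have u: "\<bar>u\<bar> = t * \<bar>a - b\<bar> / 2" using pos by (simp add: u_def abs_mult)
  have u1: "t * \<alpha> / 2 \<le> \<bar>u\<bar>" "\<bar>u\<bar> \<le> t * \<beta> / 2"
    unfolding u using zs[OF ab] pos by auto
  have "0 < t * \<alpha> / 2" using pos by simp
  have "(\<Sum>x\<in>Q'. \<Sum>y\<in>Q'-{x}. \<bar>cos (u * (v x - v y))\<bar>)
     \<le> exp (- (\<kappa>\<^sup>2 / 4 * (\<kappa> / 32)\<^sup>2 * (min \<bar>u\<bar> (1/2))\<^sup>2)) * (real (card Q') * (real (card Q') - 1))"
  proof (rule sum_abs_cos_le[OF k n, where J = "J \<inter> Q'"])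
    show "0 < \<bar>u\<bar>" using u1(1) \<open>0 < t * \<alpha> / 2\<close> by linarith
    show "\<bar>u\<bar> \<le> \<kappa> / 16 * real n" using u1 t by linarith
  qed (use Q' Q J' v in auto)
  also have "\<dots> \<le> exp (- (\<kappa>\<^sup>2 / 4 * (\<kappa> / 32)\<^sup>2 * (min (t * \<alpha> / 2) (1/2))\<^sup>2))
      * (real (card Q') * (real (card Q') - 1))"
  proof -
    have "min (t * \<alpha> / 2) (1/2) \<le> min \<bar>u\<bar> (1/2)" using u1 by auto
    moreover have "0 \<le> min (t * \<alpha> / 2) (1/2)" using pos by simp
    ultimately show ?thesis
      using Q'(3) k by (intro mult_right_mono iffD2[OF exp_le_cancel_iff] le_imp_neg_le
          mult_left_mono power_mono) auto
  qed
  finally show "(\<Sum>x\<in>Q'. \<Sum>y\<in>Q'-{x}. \<bar>cos (t * (a - b) * (v x - v y) / 2)\<bar>)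
     \<le> exp (- (\<kappa>\<^sup>2 / 4 * (\<kappa> / 32)\<^sup>2 * (min (t * \<alpha> / 2) (1/2))\<^sup>2))
      * (real (card Q') * (real (card Q') - 1))"
    by (simp add: u_def mult_ac)
qed auto

section \<open>Integration of the cosine bound to a small ball estimate\<close>

lemma powr_three_halves: "real n powr (3/2) = real n * sqrt n"
proof (cases "n = 0")
  case False
  have "real n powr (3/2) = real n powr (1 + 1/2)" by simp
  also have "\<dots> = real n * sqrt n" using False by (simp only: powr_add) (simp add: powr_half_sqrt)
  finally show ?thesis .
qed auto

lemma exp_minus_le_inverse: "x \<ge> 0 \<Longrightarrow> exp (- x) \<le> 1 / (1 + x)" for x :: real
  using exp_ge_add_one_self[of x] by (simp add: exp_minus field_simps)

lemma exp_minus_le_inverse_square: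
  fixes x :: real
  assumes "x > 0" shows "exp (- x) \<le> 2 / x\<^sup>2"
proof -
  have "x\<^sup>2 / 2 \<le> exp x" using exp_lower_Taylor_quadratic[of x] assms by simp
  thus ?thesis using assms by (simp add: exp_minus field_simps)
qed

lemma exp_minus_min_le: "exp (- min a b) \<le> exp (- a) + exp (- b)" for a b :: real
  by (cases "a \<le> b") (auto simp: min_def)

text \<open>The lower bound on \<open>r\<close> says precisely that all frequencies up to 1 / r are
  admissible for the cosine bound. The average of the cosine is then at most exp (- c1 min ((t
  \<alpha> / r)^2) n), which is split into a part integrating to order \<open>r\<close> and a part
  exponentially small in \<open>n\<close>.\<close>

lemma perm_avg_small_ball:
  fixes v :: "nat \<Rightarrow> real"
  assumes k: "0 < \<kappa>" "\<kappa> \<le> 1" and n: "8 / \<kappa> \<le> real n"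
    and Q: "Q \<subseteq> {1..n}" and J: "J \<subseteq> Q" "\<kappa> * real n + 2 * real (length zs) \<le> real (card J)"
    and v: "\<And>i. i \<in> J \<Longrightarrow> v i = real i / real n"
    and zs: "\<And>a b. (a, b) \<in> set zs \<Longrightarrow> \<alpha> / sqrt n \<le> \<bar>a - b\<bar> \<and> \<bar>a - b\<bar> \<le> \<beta> / sqrt n"
    and len: "\<eta> * real n \<le> real (length zs)"
    and pos: "0 < \<alpha>" "0 < \<beta>" "0 < \<eta>"
    and r: "8 * \<beta> / \<kappa> / (real n * sqrt n) \<le> r"
    and c1: "c1 = \<kappa>\<^sup>2 / 4 * (\<kappa> / 32)\<^sup>2 * \<eta> / 4"
  shows "perm_avg Q (\<lambda>xs. of_bool (\<bar>wsum v (flat_pairs zs @ ws) xs - L\<bar> \<le> r))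
    \<le> 4 * (2 * r / (\<alpha> * sqrt c1) + 2 / c1\<^sup>2 / (real n * sqrt n))"
proof -
  have fin: "finite Q" using Q finite_subset by blast
  have "0 < 8 / \<kappa>" using k by simp
  hence n0: "real n > 0" using n by linarith
  hence n1: "real n \<ge> 1" by simp
  have "0 < 8 * \<beta> / \<kappa> / (real n * sqrt n)" using k pos n0 by simp
  hence r0: "r > 0" using r by linarith
  have c0: "c1 > 0" unfolding c1 using k pos by (intro divide_pos_pos mult_pos_pos) auto
  \<comment> \<open>Chosen so that (a t)^2 = c1 (t \<alpha> / r)^2; the integral bound 2 / a is then
    a multiple of \<open>r\<close>.\<close>
  define a where "a = sqrt c1 * (\<alpha> / r)"
  have a0: "a > 0" using c0 pos r0 by (simp add: a_def)
  define h where "h t = 1 / (1 + (a * t)\<^sup>2) + exp (- (c1 * n))" for t :: real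
  have hint: "h integrable_on {0..1}" unfolding h_def
    by (intro integrable_add integral_inverse_quadratic_le(1)[OF a0]) auto
  have "perm_avg Q (\<lambda>xs. of_bool (\<bar>wsum v (flat_pairs zs @ ws) xs - L\<bar> \<le> r)) \<le> 4 * integral {0..1} h"
  proof (rule perm_avg_small_ball_le[OF r0 hint])
    fix t :: real assume t: "t \<in> {0..1}"
    show "\<bar>perm_avg Q (\<lambda>xs. cos (t / r * (wsum v (flat_pairs zs @ ws) xs - L)))\<bar> \<le> h t"
    proof (cases "t = 0")
      case True
      thus ?thesis using fin by (simp add: h_def)
    next
      case False
      let ?m = "min (t / r * (\<alpha> / sqrt n) / 2) (1/2)"
      have "\<bar>perm_avg Q (\<lambda>xs. cos (t / r * ((- L) + wsum v (flat_pairs zs @ ws) xs)))\<bar>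
         \<le> exp (- (\<kappa>\<^sup>2 / 4 * (\<kappa> / 32)\<^sup>2 * ?m\<^sup>2)) ^ length zs"
      proof (rule abs_perm_avg_cos_le_exp[OF k n Q J v zs])
        have "t / r * (\<beta> / sqrt n) / 2 \<le> 1 / r * (\<beta> / sqrt n) / 2"
          using t r0 pos n0 by (intro divide_right_mono mult_right_mono) auto
        also have "\<dots> \<le> \<kappa> / 16 * real n"
          using r r0 k n0 by (simp add: field_simps)
        finally show "t / r * (\<beta> / sqrt n) / 2 \<le> \<kappa> / 16 * real n" .
      qed (use pos t r0 n0 False in auto)
      also have "\<dots> = exp (- (\<kappa>\<^sup>2 / 4 * (\<kappa> / 32)\<^sup>2 * ?m\<^sup>2 * length zs))"
        by (simp add: exp_of_nat_mult[symmetric] mult_ac)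
      also have "\<dots> \<le> exp (- (\<kappa>\<^sup>2 / 4 * (\<kappa> / 32)\<^sup>2 * ?m\<^sup>2 * (\<eta> * n)))"
        using len k by (intro iffD2[OF exp_le_cancel_iff] le_imp_neg_le mult_left_mono) auto
      \<comment> \<open>The last factor 1/4 of \<open>c1\<close> is compensated by the 4 here, so
        that the remaining factor is a minimum without constants. With z = t \<alpha> / r its two
        branches meet at z = sqrt n.\<close>
      also have "\<kappa>\<^sup>2 / 4 * (\<kappa> / 32)\<^sup>2 * ?m\<^sup>2 * (\<eta> * n) = c1 * (4 * n * ?m\<^sup>2)"
        by (simp add: c1)
      also have "4 * n * ?m\<^sup>2 = min ((t * \<alpha> / r)\<^sup>2) (real n)"
      proof -
        define z where "z = t * \<alpha> / r"
        have m: "?m = min (z / (2 * sqrt n)) (1/2)" by (simp add: z_def)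
        have z0: "z \<ge> 0" using t pos r0 by (simp add: z_def)
        show ?thesis unfolding m z_def[symmetric]
        proof (cases "z \<le> sqrt n")
          case True
          hence "z\<^sup>2 \<le> (sqrt n)\<^sup>2" using z0 by (intro power_mono)
          moreover have "z / (2 * sqrt n) \<le> 1/2" using True n0 by (simp add: divide_le_eq)
          ultimately show "4 * n * (min (z / (2 * sqrt n)) (1/2))\<^sup>2 = min (z\<^sup>2) (real n)"
            using n0 by (simp add: min_absorb1 power_divide power_mult_distrib)
        next
          case False
          hence "(sqrt n)\<^sup>2 \<le> z\<^sup>2" by (intro power_mono) auto
          moreover have "1/2 \<le> z / (2 * sqrt n)" using False n0 by (simp add: le_divide_eq)
          ultimately show "4 * n * (min (z / (2 * sqrt n)) (1/2))\<^sup>2 = min (z\<^sup>2) (real n)"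
            using n0 by (simp add: min_absorb2 power_divide)
        qed
      qed
      also have "exp (- (c1 * min ((t * \<alpha> / r)\<^sup>2) (real n))) \<le>
          exp (- (c1 * (t * \<alpha> / r)\<^sup>2)) + exp (- (c1 * n))"
        using c0 exp_minus_min_le[of "c1 * (t * \<alpha> / r)\<^sup>2" "c1 * n"]
        by (simp add: min_mult_distrib_left)
      also have "c1 * (t * \<alpha> / r)\<^sup>2 = (a * t)\<^sup>2"
        using c0 by (simp add: a_def power_mult_distrib power_divide)
      also have "exp (- (a * t)\<^sup>2) + exp (- (c1 * n)) \<le> h t"
        unfolding h_def by (intro add_right_mono exp_minus_le_inverse) auto
      finally show ?thesis by simp
    qed
  qed
  also have "integral {0..1} h \<le> 2 / a + exp (- (c1 * n))"
    unfolding h_def using integral_inverse_quadratic_le[OF a0]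
    by (subst integral_add) auto
  also have "exp (- (c1 * n)) \<le> 2 / c1\<^sup>2 / (real n * sqrt n)"
  proof -
    have "exp (- (c1 * n)) \<le> 2 / (c1 * n)\<^sup>2"
      using c0 n0 by (intro exp_minus_le_inverse_square) auto
    also have "\<dots> = 2 / c1\<^sup>2 / (real n * real n)" by (simp add: power2_eq_square)
    also have "\<dots> \<le> 2 / c1\<^sup>2 / (real n * sqrt n)"
    proof (intro divide_left_mono mult_left_mono)
      have "n \<le> n\<^sup>2" using n1 by (intro self_le_power) auto
      thus "sqrt n \<le> real n" by (intro real_le_lsqrt) (simp_all flip: of_nat_power)
    qed (use n0 c0 in auto)
    finally show ?thesis .
  qed
  finally show ?thesis using r0 by (simp add: a_def field_simps)
qed

text \<open>Once the values \<open>ys\<close> at the positions \<open>T\<close> are fixed, linearly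
  many wide pairs of positions and most grid values are still left. The enumeration
  \<open>qs\<close> begins with these pairs and is chosen before \<open>r\<close>, \<open>L\<close>
  and \<open>ys\<close>, so one bound holds for every outcome at \<open>T\<close>. The summand 1 in
  the size of \<open>T\<close> leaves room for the rounding of residue classes.\<close>

lemma conditional_small_ball:
  assumes eps: "0 < \<epsilon>" "\<epsilon> < 1/2" and del: "\<delta> > 0"
  obtains K \<eta> :: real where "K > 0" "\<eta> > 0"
    "\<And>n w I v A T. n \<ge> 2 \<Longrightarrow> weights_ok \<epsilon> A n w \<Longrightarrow> values_ok \<delta> n I v \<Longrightarrow> T \<subseteq> {1..n} \<Longrightarrow>
      real (card T) \<le> \<eta> * real n + 1 \<Longrightarrow>
      \<exists>qs. distinct qs \<and> set qs = {1..n} - T \<and>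
        (\<forall>r L ys. 1 / real n powr (3/2) \<le> r \<longrightarrow> distinct ys \<longrightarrow> set ys \<subseteq> {1..n} \<longrightarrow> length ys = card T \<longrightarrow>
          perm_avg ({1..n} - set ys) (\<lambda>zs. of_bool (\<bar>wsum v (map w qs) zs - L\<bar> \<le> r)) \<le> K * r)"
proof -
  \<comment> \<open>The factor 16 leaves room for \<open>T\<close> and about \<eta> n pairs, both
    among the positions, where \<epsilon> n / 2 may be lost, and among the \<delta> n grid values,
    of which \<eta> n must survive.\<close>
  define \<eta> where "\<eta> = min \<epsilon> (min \<delta> 1) / 16"
  have eta: "0 < \<eta>" "\<eta> \<le> 1" "16 * \<eta> \<le> \<epsilon>" "16 * \<eta> \<le> \<delta>" using eps del by (auto simp: \<eta>_def)
  define \<beta> where "\<beta> = 4 / \<epsilon>"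
  \<comment> \<open>The factor by which the radius is enlarged to meet the lower bound on
    \<open>r\<close> in \<open>perm_avg_small_ball\<close>, with \<kappa> = \<eta>.\<close>
  define \<rho> where "\<rho> = 8 * \<beta> / \<eta>"
  define c1 where "c1 = \<eta>\<^sup>2 / 4 * (\<eta> / 32)\<^sup>2 * (\<eta> / 2) / 4"
  define K1 where "K1 = 4 * (2 * \<rho> / (\<epsilon> * sqrt c1) + 2 / c1\<^sup>2)"
  \<comment> \<open>The first summand handles n < 8 / \<eta>, where the trivial bound 1 is enough;
    the second handles all larger n.\<close>
  define K where "K = (8 / \<eta>)\<^sup>2 + K1"
  have c1: "c1 > 0" using eta by (simp add: c1_def)
  have beta: "\<beta> \<ge> 1" using eps by (simp add: \<beta>_def)
  have "1 * 1 \<le> 8 * \<beta>" using beta by simp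
  also have "\<dots> \<le> 8 * \<beta> / \<eta>" using eta beta by (simp add: le_divide_eq)
  finally have rho: "\<rho> \<ge> 1" by (simp add: \<rho>_def)
  have K1: "K1 > 0" unfolding K1_def using rho eps c1
    by (intro mult_pos_pos add_pos_pos divide_pos_pos) auto
  have K: "K > 0" "K1 \<le> K" "(8 / \<eta>)\<^sup>2 \<le> K" using K1 eta by (auto simp: K_def intro: add_nonneg_pos)
  show ?thesis
  proof (rule that[OF K(1) eta(1)])
    fix n :: nat and w v :: "nat \<Rightarrow> real" and I T :: "nat set" and A :: real
    assume n2: "n \<ge> 2" and w: "weights_ok \<epsilon> A n w" and v: "values_ok \<delta> n I v" and T: "T \<subseteq> {1..n}"
      "real (card T) \<le> \<eta> * real n + 1"
    have n0: "real n > 0" using n2 by simp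
    have finT: "finite T" using T finite_subset by blast
    show "\<exists>qs. distinct qs \<and> set qs = {1..n} - T \<and>
        (\<forall>r L ys. 1 / real n powr (3/2) \<le> r \<longrightarrow> distinct ys \<longrightarrow> set ys \<subseteq> {1..n} \<longrightarrow> length ys = card T \<longrightarrow>
          perm_avg ({1..n} - set ys) (\<lambda>zs. of_bool (\<bar>wsum v (map w qs) zs - L\<bar> \<le> r)) \<le> K * r)"
    proof (cases "8 / \<eta> \<le> real n")
      case False
      obtain qs where qs: "set qs = {1..n} - T" "distinct qs"
        using finite_distinct_list[of "{1..n} - T"] by auto
      have "perm_avg ({1..n} - set ys) (\<lambda>zs. of_bool (\<bar>wsum v (map w qs) zs - L\<bar> \<le> r)) \<le> K * r"
        if r: "1 / real n powr (3/2) \<le> r" for r L and ys :: "nat list"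
      proof -
        have "perm_avg ({1..n} - set ys) (\<lambda>zs. of_bool (\<bar>wsum v (map w qs) zs - L\<bar> \<le> r))
           \<le> perm_avg ({1..n} - set ys) (\<lambda>_. 1)" by (intro perm_avg_mono) auto
        also have "\<dots> = 1" by simp
        also have "1 \<le> (8 / \<eta>)\<^sup>2 / real n powr (3/2)"
        proof -
          have "real n powr (3/2) \<le> real n powr 2" using n2 by (intro powr_mono) auto
          also have "\<dots> = (real n)\<^sup>2" using n0 by (simp add: powr_numeral)
          also have "\<dots> \<le> (8 / \<eta>)\<^sup>2" using False by (intro power_mono) auto
          finally show ?thesis using n0 by (simp add: le_divide_eq)
        qed
        also have "\<dots> \<le> (8 / \<eta>)\<^sup>2 * r" using r mult_left_mono[OF r, of "(8 / \<eta>)\<^sup>2"] by simp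
        also have "\<dots> \<le> K * r"
          using K(3) r by (intro mult_right_mono) (auto intro: order.trans[rotated])
        finally show ?thesis .
      qed
      thus ?thesis using qs by blast
    next
      case True
      hence en: "8 \<le> \<eta> * real n" using eta by (simp add: divide_le_eq mult.commute)
      have en2: "16 * (\<eta> * n) \<le> \<epsilon> * n" "16 * (\<eta> * n) \<le> \<delta> * n"
        using mult_right_mono[OF eta(3), of n] mult_right_mono[OF eta(4), of n] by (simp_all add: mult.assoc)
      \<comment> \<open>Because \<eta> n \<ge> 8, rounding down keeps at least \<eta> n / 2 pairs,
        which explains the density \<open>\<eta> / 2\<close> in \<open>c1\<close>.\<close>
      define k where "k = nat \<lfloor>\<eta> * real n\<rfloor>"
      have k: "real k \<le> \<eta> * n" "\<eta> * n - 1 \<le> real k" using en unfolding k_def by linarith+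
      define R where "R a b \<longleftrightarrow> \<epsilon> / sqrt n \<le> \<bar>w a - w b\<bar> \<and> \<bar>w a - w b\<bar> \<le> \<beta> / sqrt n" for a b
      have "\<exists>zs. length zs = k \<and> distinct (flat_pairs zs) \<and> set (flat_pairs zs) \<subseteq> {1..n} - T \<and>
        (\<forall>(a, b)\<in>set zs. R a b)"
      proof (rule exists_disjoint_pairs)
        fix X assume X: "X \<subseteq> {1..n} - T" "card X \<le> 2 * k" "finite X"
        have "card (X \<union> T) \<le> card X + card T" by (rule card_Un_le)
        hence "real (card (X \<union> T)) \<le> 2 * real k + (\<eta> * n + 1)" using X(2) T(2) by linarith
        also have "\<dots> \<le> \<epsilon> / 2 * n" using k en en2 by simp
        finally have "\<exists>a\<in>{1..n}-(X \<union> T). \<exists>b\<in>{1..n}-(X \<union> T). a \<noteq> b \<and> \<epsilon> / sqrt n \<le> \<bar>w a - w b\<bar> \<and>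
            \<bar>w a - w b\<bar> \<le> 4 / \<epsilon> / sqrt n"
          using X T n0 by (intro weights_ok_wide_pair[OF eps w]) auto
        thus "\<exists>a\<in>{1..n} - T - X. \<exists>b\<in>{1..n} - T - X. a \<noteq> b \<and> R a b"
          unfolding R_def \<beta>_def by blast
      qed
      then obtain zs where zs: "length zs = k" "distinct (flat_pairs zs)" "set (flat_pairs zs) \<subseteq> {1..n} - T"
        "\<forall>(a, b)\<in>set zs. R a b" by blast
      obtain us where us: "set us = {1..n} - T - set (flat_pairs zs)" "distinct us"
        using finite_distinct_list[of "{1..n} - T - set (flat_pairs zs)"] by auto
      let ?qs = "flat_pairs zs @ us"
      let ?ws = "map (map_prod w w) zs"
      have qs: "distinct ?qs" "set ?qs = {1..n} - T" using zs us by auto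
      have "perm_avg ({1..n} - set ys) (\<lambda>zs. of_bool (\<bar>wsum v (map w ?qs) zs - L\<bar> \<le> r)) \<le> K * r"
        if r: "1 / real n powr (3/2) \<le> r" and ys: "distinct ys" "set ys \<subseteq> {1..n}" "length ys = card T"
        for r L and ys :: "nat list"
      proof -
        have r': "1 / (real n * sqrt n) \<le> r" using r by (simp add: powr_three_halves)
        have "0 < 1 / (real n * sqrt n)" using n0 by simp
        hence r0: "r > 0" using r' by linarith
        \<comment> \<open>Enlarging the radius by \<rho> \<ge> 1 only enlarges the event, and costs
          a constant factor in the bound.\<close>
        have "perm_avg ({1..n} - set ys) (\<lambda>zs. of_bool (\<bar>wsum v (map w ?qs) zs - L\<bar> \<le> r)) \<le>
           perm_avg ({1..n} - set ys) (\<lambda>zs. of_bool (\<bar>wsum v (map w ?qs) zs - L\<bar> \<le> \<rho> * r))"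
        proof (rule perm_avg_mono)
          fix xs
          have "r \<le> \<rho> * r" using mult_right_mono[OF rho, of r] r0 by simp
          thus "of_bool (\<bar>wsum v (map w ?qs) xs - L\<bar> \<le> r) \<le>
              (of_bool (\<bar>wsum v (map w ?qs) xs - L\<bar> \<le> \<rho> * r) :: real)"
            by (simp only: of_bool_less_eq_iff) linarith
        qed
        also have "\<dots> = perm_avg ({1..n} - set ys)
            (\<lambda>xs. of_bool (\<bar>wsum v (flat_pairs ?ws @ map w us) xs - L\<bar> \<le> \<rho> * r))"
          by (simp add: map_flat_pairs)
        also have "\<dots> \<le> 4 * (2 * (\<rho> * r) / (\<epsilon> * sqrt c1) + 2 / c1\<^sup>2 / (real n * sqrt n))"
        proof (rule perm_avg_small_ball[OF eta(1,2) True, where J = "I - set ys" and \<beta> = \<beta> and \<eta> = "\<eta>/2"])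
          have I: "I \<subseteq> {1..n}" "\<delta> * n \<le> card I" using v by (auto simp: values_ok_def)
          have "card I \<le> card ((I - set ys) \<union> set ys)"
            using I finite_subset[OF I(1)] by (intro card_mono) auto
          also have "\<dots> \<le> card (I - set ys) + card (set ys)" by (rule card_Un_le)
          also have "card (set ys) = card T" using ys distinct_card by metis
          finally have "real (card I) \<le> real (card (I - set ys)) + real (card T)" by linarith
          thus "\<eta> * real n + 2 * real (length ?ws) \<le> real (card (I - set ys))"
            using I(2) T(2) k en en2 zs(1) by simp
          show "I - set ys \<subseteq> {1..n} - set ys" using I by auto
          show "v i = real i / real n" if "i \<in> I - set ys" for i
            using v that by (auto simp: values_ok_def)
          show "\<eta> / 2 * real n \<le> real (length ?ws)" using zs(1) k en by simp
          show "8 * \<beta> / \<eta> / (real n * sqrt n) \<le> \<rho> * r"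
            using mult_left_mono[OF r', of \<rho>] rho by (simp add: \<rho>_def)
          fix a b assume "(a, b) \<in> set ?ws"
          then obtain a' b' where "(a', b') \<in> set zs" "a = w a'" "b = w b'" by auto
          thus "\<epsilon> / sqrt n \<le> \<bar>a - b\<bar> \<and> \<bar>a - b\<bar> \<le> \<beta> / sqrt n"
            using zs(4) by (auto simp: R_def)
        qed (use eps beta eta in \<open>auto simp: c1_def\<close>)
        also have "\<dots> \<le> 4 * (2 * (\<rho> * r) / (\<epsilon> * sqrt c1) + 2 / c1\<^sup>2 * r)"
          using mult_left_mono[OF r', of "2 / c1\<^sup>2"] by simp
        also have "\<dots> = K1 * r" by (simp add: K1_def algebra_simps)
        also have "\<dots> \<le> K * r" using K(2) r0 by (intro mult_right_mono) auto
        finally show ?thesis .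
      qed
      thus ?thesis using qs by blast
    qed
  qed
qed

section \<open>Subgaussian tails\<close>

text \<open>For a centred variable the linear term averages out, so this bounds the exponential
  moment by that of the square alone, without a separate treatment of large arguments.\<close>

lemma exp_le_add_exp_square: "exp x \<le> x + exp (x\<^sup>2)" for x :: real
proof -
  have sq: "1 + x\<^sup>2 \<le> exp (x\<^sup>2)" by (rule exp_ge_add_one_self)
  consider "x > 1" | "0 \<le> x" "x \<le> 1" | "x < 0" by linarith
  thus ?thesis
  proof cases
    case 1
    hence "exp x \<le> exp (x\<^sup>2)" by (simp add: power2_eq_square)
    thus ?thesis using 1 by linarith
  next
    case 2
    hence "exp x \<le> 1 + x + x\<^sup>2" by (intro exp_bound)
    thus ?thesis using sq by argo
  next
    case 3
    define y where "y = - x"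
    have y: "y > 0" using 3 by (simp add: y_def)
    \<comment> \<open>The bound exp (- y) \<le> 1 - y + y^2 is proved after multiplication by exp y,
      which is at least its quadratic Taylor polynomial.\<close>
    have "1 \<le> (1 - y + y\<^sup>2) * (1 + y + y\<^sup>2 / 2)"
    proof -
      have "(1 - y + y\<^sup>2) * (1 + y + y\<^sup>2 / 2) = 1 + (y\<^sup>2 / 2 + y ^ 3 / 2 + y ^ 4 / 2)"
        by (simp add: field_simps eval_nat_numeral)
      thus ?thesis using y by simp
    qed
    also have "\<dots> \<le> (1 - y + y\<^sup>2) * exp y"
    proof (intro mult_left_mono)
      show "1 + y + y\<^sup>2 / 2 \<le> exp y" using y exp_lower_Taylor_quadratic[of y] by simp
      have "1 - y + y\<^sup>2 = (y - 1/2)\<^sup>2 + 3/4" by (simp add: power2_eq_square algebra_simps)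
      thus "0 \<le> 1 - y + y\<^sup>2" by simp
    qed
    finally have "exp (- y) \<le> 1 - y + y\<^sup>2" by (simp add: exp_minus field_simps)
    hence "exp x \<le> 1 + x + x\<^sup>2" by (simp add: y_def)
    thus ?thesis using sq by argo
  qed
qed

lemma abs_sum_list_le:
  fixes ws :: "real list"
  assumes "\<And>b. b \<in> set ws \<Longrightarrow> \<bar>b\<bar> \<le> M"
  shows "\<bar>sum_list ws\<bar> \<le> real (length ws) * M"
  using assms
proof (induction ws)
  case (Cons a ws)
  have "\<bar>a\<bar> \<le> M" "\<bar>sum_list ws\<bar> \<le> real (length ws) * M" using Cons by auto
  thus ?case using abs_triangle_ineq[of a "sum_list ws"] by (simp add: algebra_simps)
qed auto

text \<open>
  The value at the position of largest weight is revealed first, so that the remaining weights,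
  averaged, shift the conditional mean by no more than that weight does.
\<close>

lemma perm_avg_exp_wsum_le:
  fixes v :: "'a \<Rightarrow> real"
  assumes "finite Q" "length ws \<le> card Q" "sorted_wrt (\<lambda>a b. \<bar>b\<bar> \<le> \<bar>a\<bar>) ws"
    and "\<And>x. x \<in> Q \<Longrightarrow> \<bar>v x\<bar> \<le> B"
  shows "perm_avg Q (\<lambda>xs. exp (s * (wsum v ws xs - sum_list ws * (\<Sum>x\<in>Q. v x) / real (card Q))))
    \<le> exp (16 * s\<^sup>2 * B\<^sup>2 * (\<Sum>a\<leftarrow>ws. a\<^sup>2))"
  using assms
proof (induction ws arbitrary: Q)
  case Nil
  thus ?case by simp
next
  case (Cons w ws)
  define N where "N = card Q"
  define V where "V = (\<Sum>x\<in>Q. v x)"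
  define W where "W = sum_list ws"
  define E where "E = exp (16 * s\<^sup>2 * B\<^sup>2 * (\<Sum>a\<leftarrow>ws. a\<^sup>2))"
  \<comment> \<open>The martingale difference: the change of the conditional mean of the weighted
    sum when the first position receives the value \<open>q\<close>.\<close>
  define X where "X q = (w - W / (real N - 1)) * (v q - V / real N)" for q
  have N: "N \<ge> 1" "length ws \<le> N - 1" using Cons.prems(2) by (auto simp: N_def)
  have ne: "Q \<noteq> {}" using N by (auto simp: N_def)
  have W: "\<bar>W / (real N - 1)\<bar> \<le> \<bar>w\<bar>"
  proof -
    have "\<bar>W\<bar> \<le> real (length ws) * \<bar>w\<bar>"
      unfolding W_def using Cons.prems(3) by (intro abs_sum_list_le) auto
    also have "\<dots> \<le> (real N - 1) * \<bar>w\<bar>" using N by (intro mult_right_mono) auto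
    finally show ?thesis using N(1) by (cases "N = 1") (auto simp: abs_divide divide_le_eq mult.commute)
  qed
  have V: "\<bar>V / real N\<bar> \<le> B"
  proof -
    have "\<bar>V\<bar> \<le> (\<Sum>x\<in>Q. B)" unfolding V_def
      using Cons.prems(4) by (intro order.trans[OF sum_abs] sum_mono) auto
    thus ?thesis using N(1) by (simp add: N_def abs_divide divide_le_eq mult.commute)
  qed
  have Xle: "(s * X q)\<^sup>2 \<le> 16 * s\<^sup>2 * B\<^sup>2 * w\<^sup>2" if "q \<in> Q" for q
  proof -
    have "\<bar>w - W / (real N - 1)\<bar> \<le> 2 * \<bar>w\<bar>" using W by linarith
    moreover have "\<bar>v q - V / real N\<bar> \<le> 2 * B" using V Cons.prems(4)[OF that] by linarith
    ultimately have "\<bar>X q\<bar> \<le> (2 * \<bar>w\<bar>) * (2 * B)"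
      unfolding X_def abs_mult by (intro mult_mono) auto
    hence "\<bar>X q\<bar>\<^sup>2 \<le> ((2 * \<bar>w\<bar>) * (2 * B))\<^sup>2" by (intro power_mono) auto
    hence "s\<^sup>2 * (X q)\<^sup>2 \<le> s\<^sup>2 * (16 * B\<^sup>2 * w\<^sup>2)"
      by (intro mult_left_mono) (auto simp: power_mult_distrib mult_ac)
    thus ?thesis by (simp add: power_mult_distrib mult_ac)
  qed
  have sumX: "(\<Sum>q\<in>Q. X q) = 0"
    using N(1) by (simp add: X_def sum_distrib_left[symmetric] sum_subtractf V_def N_def)
  have step: "perm_avg (Q - {q}) (\<lambda>xs. exp (s * (w * v q + wsum v ws xs - (w + W) * V / real N)))
     \<le> exp (s * X q) * E" if q: "q \<in> Q" for q
  proof -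
    have V': "(\<Sum>x\<in>Q-{q}. v x) = V - v q"
      using q Cons.prems(1) by (simp add: V_def sum_diff1)
    have N': "real (card (Q - {q})) = real N - 1"
      using q Cons.prems(1) N by (simp add: N_def of_nat_diff)
    have id: "w * v q + u - (w + W) * V / real N = X q + (u - W * (V - v q) / (real N - 1))" for u
    proof (cases "N = 1")
      \<comment> \<open>No weight remains after the first, and division by \<open>real N - 1\<close>
        = 0 yields 0, so both sides reduce to \<open>u\<close>.\<close>
      case True
      hence "Q = {q}" "ws = []" using q N by (auto simp: N_def card_1_singleton_iff)
      thus ?thesis using True by (simp add: X_def V_def W_def)
    next
      case False
      define p where "p = W / (real N - 1)"
      define m where "m = V / real N"
      have W': "W = p * (real N - 1)" and V'': "V = m * real N"
        using False N(1) by (auto simp: p_def m_def)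
      have "(w + W) * V / real N = (w + W) * m" "W * (V - v q) / (real N - 1) = p * (V - v q)"
        by (simp_all add: p_def m_def)
      moreover have "w * v q + u - (w + W) * m = (w - p) * (v q - m) + (u - p * (V - v q))"
        unfolding W' V'' by (simp add: algebra_simps)
      ultimately show ?thesis by (simp only: X_def flip: p_def m_def)
    qed
    have "perm_avg (Q - {q}) (\<lambda>xs. exp (s * (w * v q + wsum v ws xs - (w + W) * V / real N))) =
       exp (s * X q) * perm_avg (Q - {q}) (\<lambda>xs. exp (s * (wsum v ws xs - W * (V - v q) / (real N - 1))))"
      unfolding id by (simp add: distrib_left exp_add perm_avg_cmult)
    also have "perm_avg (Q - {q}) (\<lambda>xs. exp (s * (wsum v ws xs - W * (V - v q) / (real N - 1)))) \<le> E"
      unfolding E_def V'[symmetric] N'[symmetric] W_def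
      using Cons.prems q by (intro Cons.IH) auto
    finally show ?thesis by simp
  qed
  have "perm_avg Q (\<lambda>xs. exp (s * (wsum v (w # ws) xs - sum_list (w # ws) * (\<Sum>x\<in>Q. v x) / real (card Q))))
     = (\<Sum>q\<in>Q. perm_avg (Q - {q}) (\<lambda>xs. exp (s * (w * v q + wsum v ws xs - (w + W) * V / real N)))) / real N"
    unfolding perm_avg_rec[OF Cons.prems(1) ne] by (simp add: W_def V_def N_def)
  also have "\<dots> \<le> (\<Sum>q\<in>Q. exp (s * X q) * E) / real N"
    by (intro divide_right_mono sum_mono step) auto
  also have "(\<Sum>q\<in>Q. exp (s * X q) * E) = (\<Sum>q\<in>Q. exp (s * X q)) * E"
    by (simp add: sum_distrib_right)
  \<comment> \<open>The linear terms cancel by \<open>sumX\<close>, so revealing this value costs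
    only the factor exp (16 s^2 B^2 w^2).\<close>
  also have "(\<Sum>q\<in>Q. exp (s * X q)) \<le> (\<Sum>q\<in>Q. s * X q + exp (16 * s\<^sup>2 * B\<^sup>2 * w\<^sup>2))"
  proof (intro sum_mono)
    fix q assume "q \<in> Q"
    thus "exp (s * X q) \<le> s * X q + exp (16 * s\<^sup>2 * B\<^sup>2 * w\<^sup>2)"
      using exp_le_add_exp_square[of "s * X q"] Xle[of q]
      by (meson add_left_mono exp_le_cancel_iff order.trans)
  qed
  also have "\<dots> = real N * exp (16 * s\<^sup>2 * B\<^sup>2 * w\<^sup>2)"
    by (simp add: sum.distrib sum_distrib_left[symmetric] sumX N_def)
  also have "real N * exp (16 * s\<^sup>2 * B\<^sup>2 * w\<^sup>2) * E / real N = exp (16 * s\<^sup>2 * B\<^sup>2 * (\<Sum>a\<leftarrow>w # ws. a\<^sup>2))"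
    using N(1) by (simp add: E_def exp_add[symmetric] distrib_left)
  finally show ?case
    by (simp add: E_def mult_right_mono divide_right_mono)
qed

text \<open>Exponential Markov inequality for both signs of the deviation.\<close>

lemma perm_avg_wsum_tail_le:
  fixes v :: "'a \<Rightarrow> real"
  assumes Q: "finite Q" "length ws \<le> card Q" and ws: "sorted_wrt (\<lambda>a b. \<bar>b\<bar> \<le> \<bar>a\<bar>) ws"
    "(\<Sum>a\<leftarrow>ws. a\<^sup>2) \<le> 1"
    and v: "\<And>x. x \<in> Q \<Longrightarrow> \<bar>v x\<bar> \<le> B" and B: "B > 0" and y: "y \<ge> 0"
  shows "perm_avg Q (\<lambda>xs. of_bool (y \<le> \<bar>wsum v ws xs - sum_list ws * (\<Sum>x\<in>Q. v x) / real (card Q)\<bar>))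
    \<le> 2 * exp (- (y\<^sup>2 / (64 * B\<^sup>2)))"
proof -
  \<comment> \<open>The minimiser of - s y + 16 s^2 B^2.\<close>
  define s where "s = y / (32 * B\<^sup>2)"
  define X where "X xs = wsum v ws xs - sum_list ws * (\<Sum>x\<in>Q. v x) / real (card Q)" for xs
  have s: "s \<ge> 0" using y by (simp add: s_def)
  have mgf: "perm_avg Q (\<lambda>xs. exp (s' * X xs)) \<le> exp (16 * s\<^sup>2 * B\<^sup>2)" if "s'\<^sup>2 = s\<^sup>2" for s'
  proof -
    have "perm_avg Q (\<lambda>xs. exp (s' * X xs)) \<le> exp (16 * s'\<^sup>2 * B\<^sup>2 * (\<Sum>a\<leftarrow>ws. a\<^sup>2))"
      unfolding X_def by (rule perm_avg_exp_wsum_le[OF Q ws(1) v])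
    also have "\<dots> \<le> exp (16 * s'\<^sup>2 * B\<^sup>2 * 1)"
      using ws(2) by (intro iffD2[OF exp_le_cancel_iff] mult_left_mono) auto
    finally show ?thesis using that by simp
  qed
  have "perm_avg Q (\<lambda>xs. of_bool (y \<le> \<bar>X xs\<bar>)) \<le>
      perm_avg Q (\<lambda>xs. exp (- (s * y)) * (exp (s * X xs) + exp ((- s) * X xs)))"
  proof (rule perm_avg_mono)
    fix xs
    have "1 \<le> exp (- (s * y)) * (exp (s * X xs) + exp ((- s) * X xs))" if "y \<le> \<bar>X xs\<bar>"
    proof -
      have "s * y \<le> s * \<bar>X xs\<bar>" using that s by (intro mult_left_mono)
      hence "exp (s * y) \<le> exp (s * \<bar>X xs\<bar>)" by simp
      also have "\<dots> \<le> exp (s * X xs) + exp ((- s) * X xs)" by (cases "X xs \<ge> 0") auto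
      finally show ?thesis by (simp add: exp_minus field_simps)
    qed
    thus "of_bool (y \<le> \<bar>X xs\<bar>) \<le> exp (- (s * y)) * (exp (s * X xs) + exp ((- s) * X xs))"
      by (auto simp: of_bool_def)
  qed
  also have "\<dots> = exp (- (s * y)) * (perm_avg Q (\<lambda>xs. exp (s * X xs)) + perm_avg Q (\<lambda>xs. exp ((- s) * X xs)))"
    by (simp only: perm_avg_cmult perm_avg_add)
  also have "\<dots> \<le> exp (- (s * y)) * (exp (16 * s\<^sup>2 * B\<^sup>2) + exp (16 * s\<^sup>2 * B\<^sup>2))"
    by (intro mult_left_mono add_mono mgf) auto
  also have "\<dots> = 2 * exp (- (s * y) + 16 * s\<^sup>2 * B\<^sup>2)"
    unfolding exp_add by simp
  also have "- (s * y) + 16 * s\<^sup>2 * B\<^sup>2 = - (y\<^sup>2 / (64 * B\<^sup>2))"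
    using B by (simp add: s_def power_divide power_mult_distrib field_simps power2_eq_square)
  finally show ?thesis unfolding X_def .
qed

section \<open>Tails combined with small balls\<close>

text \<open>On a residue class the quotient \<open>i div m\<close> determines
  \<open>i\<close>.\<close>

lemma card_mod_class_le:
  fixes n m j :: nat
  assumes "m > 0"
  shows "real (card {i\<in>{1..n}. i mod m = j}) \<le> real n / real m + 1"
proof -
  have "inj_on (\<lambda>i. i div m) {i\<in>{1..n}. i mod m = j}"
    by (rule inj_onI) (metis (mono_tags, lifting) mem_Collect_eq mult_div_mod_eq)
  moreover have "(\<lambda>i. i div m) ` {i\<in>{1..n}. i mod m = j} \<subseteq> {..n div m}"
    by (auto intro!: div_le_mono)
  ultimately have "card {i\<in>{1..n}. i mod m = j} \<le> card {..n div m}"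
    by (intro card_inj_on_le) auto
  hence "real (card {i\<in>{1..n}. i mod m = j}) \<le> real (n div m) + 1" by simp
  also have "real (n div m) \<le> real n / real m" by (rule of_nat_div_le_of_nat)
  finally show ?thesis by simp
qed

lemma wsum_map_eq_sum:
  assumes "distinct ps" "set ps = T"
  shows "wsum v (map w ps) (map \<pi> ps) = (\<Sum>p\<in>T. w p * v (\<pi> p))"
  using assms by (simp add: wsum_map_map sum_list_distinct_conv_sum_set)

text \<open>The positions of \<open>T\<close> are read first. The tail event depends on their values
  alone, and given these values the whole sum is close to \<open>L\<close> only if the sum over
  \<open>qs\<close> is close to a shifted centre. The hypothesis \<open>small\<close> covers every
  centre, so the two bounds multiply.\<close>

lemma prob_tail_inter_small_ball_le:
  fixes w v :: "nat \<Rightarrow> real"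
  assumes T: "T \<subseteq> {1..n}" and w: "(\<Sum>i=1..n. (w i)\<^sup>2) \<le> 1"
    and v: "\<And>i. i \<in> {1..n} \<Longrightarrow> \<bar>v i\<bar> \<le> B" and B: "B > 0" and y: "y \<ge> 0" and M: "M \<ge> 0"
    and qs: "distinct qs" "set qs = {1..n} - T"
    and small: "\<And>L ys. distinct ys \<Longrightarrow> set ys \<subseteq> {1..n} \<Longrightarrow> length ys = card T \<Longrightarrow>
      perm_avg ({1..n} - set ys) (\<lambda>zs. of_bool (\<bar>wsum v (map w qs) zs - L\<bar> \<le> r)) \<le> M"
  shows "measure_pmf.prob (perm_pmf n)
     {\<pi>. y \<le> \<bar>(\<Sum>i\<in>T. w i * v (\<pi> i)) - (\<Sum>i\<in>T. w i) * (\<Sum>i=1..n. v i) / real n\<bar> \<and>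
         \<bar>perm_sum n w v \<pi> - L\<bar> \<le> r} \<le> 2 * exp (- (y\<^sup>2 / (64 * B\<^sup>2))) * M"
proof -
  have finT: "finite T" using T finite_subset by blast
  \<comment> \<open>Decreasing absolute weight is the order that the exponential moment bound
    requires.\<close>
  define ts where "ts = sort_key (\<lambda>i. - \<bar>w i\<bar>) (sorted_list_of_set T)"
  have ts: "distinct ts" "set ts = T" using finT by (auto simp: ts_def)
  have lts: "length ts = card T" using ts distinct_card by metis
  have "sorted (map (\<lambda>i. - \<bar>w i\<bar>) ts)" unfolding ts_def by (rule sorted_sort_key)
  hence srt: "sorted_wrt (\<lambda>a b. \<bar>b\<bar> \<le> \<bar>a\<bar>) (map w ts)"
    by (simp add: sorted_map sorted_wrt_map)
  let ?ps = "ts @ qs"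
  have ps: "distinct ?ps" "set ?ps = {1..n}" using ts qs T by auto
  define \<mu> where "\<mu> = sum_list (map w ts) * (\<Sum>i\<in>{1..n}. v i) / real (card {1..n})"
  have mu: "\<mu> = (\<Sum>i\<in>T. w i) * (\<Sum>i=1..n. v i) / real n"
    using ts by (simp add: \<mu>_def sum_list_distinct_conv_sum_set)
  have "measure_pmf.prob (perm_pmf n)
     {\<pi>. y \<le> \<bar>(\<Sum>i\<in>T. w i * v (\<pi> i)) - (\<Sum>i\<in>T. w i) * (\<Sum>i=1..n. v i) / real n\<bar> \<and>
         \<bar>perm_sum n w v \<pi> - L\<bar> \<le> r} =
     measure_pmf.prob (perm_pmf n) {\<pi>. y \<le> \<bar>wsum v (map w ts) (take (card T) (map \<pi> ?ps)) - \<mu>\<bar> \<and>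
         \<bar>wsum v (map w ?ps) (map \<pi> ?ps) - L\<bar> \<le> r}"
    unfolding wsum_map_eq_sum[OF ps] perm_sum_def mu
    by (simp add: wsum_map_eq_sum[OF ts] lts[symmetric])
  also have "\<dots> = perm_avg {1..n} (\<lambda>xs. of_bool (y \<le> \<bar>wsum v (map w ts) (take (card T) xs) - \<mu>\<bar> \<and>
         \<bar>wsum v (map w ?ps) xs - L\<bar> \<le> r))"
    by (rule prob_perm_pmf[OF ps])
  also have "\<dots> = perm_avg {1..n} (\<lambda>xs. of_bool (y \<le> \<bar>wsum v (map w ts) (take (card T) xs) - \<mu>\<bar>) *
         of_bool (\<bar>wsum v (map w ?ps) xs - L\<bar> \<le> r))"
    by (simp add: of_bool_conj)
  also have "\<dots> \<le> perm_avg {1..n} (\<lambda>xs. of_bool (y \<le> \<bar>wsum v (map w ts) (take (card T) xs) - \<mu>\<bar>)) * M"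
  proof (rule perm_avg_prefix_le[where g = "\<lambda>ys. of_bool (y \<le> \<bar>wsum v (map w ts) ys - \<mu>\<bar>)"])
    show "card T \<le> card {1..n}" using T by (intro card_mono) auto
    fix ys assume ys: "length ys = card T" "distinct ys" "set ys \<subseteq> {1..n}"
    have *: "wsum v (map w ?ps) (ys @ zs) - L = wsum v (map w qs) zs - (L - wsum v (map w ts) ys)" for zs
      using ys lts by (simp add: wsum_append)
    show "perm_avg ({1..n} - set ys) (\<lambda>zs. of_bool (\<bar>wsum v (map w ?ps) (ys @ zs) - L\<bar> \<le> r)) \<le> M"
      unfolding * by (rule small[OF ys(2,3,1)])
  qed auto
  also have "perm_avg {1..n} (\<lambda>xs. of_bool (y \<le> \<bar>wsum v (map w ts) (take (card T) xs) - \<mu>\<bar>)) =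
     perm_avg {1..n} (\<lambda>xs. of_bool (y \<le> \<bar>wsum v (map w ts) xs - \<mu>\<bar>))"
    using wsum_take[of v "map w ts"] lts by simp
  also have "\<dots> * M \<le> 2 * exp (- (y\<^sup>2 / (64 * B\<^sup>2))) * M"
    unfolding \<mu>_def
  proof (intro mult_right_mono M perm_avg_wsum_tail_le srt v B y)
    show "length (map w ts) \<le> card {1..n}" using lts T card_mono[of "{1..n}" T] by simp
    have "(\<Sum>a\<leftarrow>map w ts. a\<^sup>2) = (\<Sum>i\<in>T. (w i)\<^sup>2)"
      using ts by (simp add: sum_list_distinct_conv_sum_set o_def)
    also have "\<dots> \<le> (\<Sum>i=1..n. (w i)\<^sup>2)" using T by (intro sum_mono2) auto
    finally show "(\<Sum>a\<leftarrow>map w ts. a\<^sup>2) \<le> 1" using w by linarith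
  qed auto
  finally show ?thesis .
qed

section \<open>Assembly of the uniform small ball bound and of the bound with Gaussian decay in
  L\<close>

theorem theorem2p8:
  fixes \<epsilon> \<delta> :: real
  assumes "0 < \<epsilon>" and "\<epsilon> < 1/2" and "\<delta> > 0"
  shows "\<exists>A0::real. A0 > 0 \<and> (\<forall>A::real. A \<ge> A0 \<longrightarrow>
    (\<exists>K::real. \<forall>(n::nat) (w::nat \<Rightarrow> real) (I::nat set) (v::nat \<Rightarrow> real).
       n \<ge> 2 \<and> weights_ok \<epsilon> A n w \<and> values_ok \<delta> n I v \<longrightarrow>
       (\<forall>L::real.
          measure_pmf.prob (perm_pmf n)
            {\<pi>. \<bar>perm_sum n w v \<pi> - L\<bar> \<le> 1 / real n powr (3/2)}
          \<le> K / real n powr (3/2))) \<and>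
    (\<forall>B::real. B > 0 \<longrightarrow>
      (\<exists>(K'::real) (c::real). K' > 0 \<and> c > 0 \<and>
        (\<forall>(n::nat) (w::nat \<Rightarrow> real) (I::nat set) (v::nat \<Rightarrow> real).
           n \<ge> 2 \<and> weights_ok \<epsilon> A n w \<and> values_ok \<delta> n I v \<and>
           (\<forall>i\<in>{1..n}. \<bar>v i\<bar> \<le> B) \<longrightarrow>
           (\<forall>L::real.
              measure_pmf.prob (perm_pmf n)
                {\<pi>. \<bar>perm_sum n w v \<pi> - L\<bar> \<le> 1 / real n powr (3/2 - \<epsilon>)}
              \<le> K' / real n powr (3/2 - \<epsilon>) * exp (- c * L\<^sup>2))))))"
proof -
  obtain K \<eta> :: real where K: "K > 0" and eta: "\<eta> > 0" and
    core: "\<And>n w I v A T. n \<ge> 2 \<Longrightarrow> weights_ok \<epsilon> A n w \<Longrightarrow> values_ok \<delta> n I v \<Longrightarrow> T \<subseteq> {1..n} \<Longrightarrow>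
      real (card T) \<le> \<eta> * real n + 1 \<Longrightarrow>
      \<exists>qs. distinct qs \<and> set qs = {1..n} - T \<and>
        (\<forall>r L ys. 1 / real n powr (3/2) \<le> r \<longrightarrow> distinct ys \<longrightarrow> set ys \<subseteq> {1..n} \<longrightarrow> length ys = card T \<longrightarrow>
          perm_avg ({1..n} - set ys) (\<lambda>zs. of_bool (\<bar>wsum v (map w qs) zs - L\<bar> \<le> r)) \<le> K * r)"
    using conditional_small_ball[OF assms] by blast
  \<comment> \<open>The conditional estimate with no position fixed, that is, \<open>T\<close> and
    \<open>ys\<close> empty.\<close>
  have small: "measure_pmf.prob (perm_pmf n) {\<pi>. \<bar>perm_sum n w v \<pi> - L\<bar> \<le> r} \<le> K * r"
    if h: "n \<ge> 2" "weights_ok \<epsilon> A n w" "values_ok \<delta> n I v" and r: "1 / real n powr (3/2) \<le> r"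
    for n w I v A r L
  proof -
    obtain qs where qs: "distinct qs" "set qs = {1..n}"
      "perm_avg {1..n} (\<lambda>zs. of_bool (\<bar>wsum v (map w qs) zs - L\<bar> \<le> r)) \<le> K * r"
      using core[OF h, of "{}"] eta r by auto
    show ?thesis
      using qs(3) prob_perm_pmf[OF qs(1,2), of "\<lambda>xs. \<bar>wsum v (map w qs) xs - L\<bar> \<le> r"]
      by (simp add: wsum_map_eq_sum[OF qs(1,2)] perm_sum_def)
  qed
  have part_b: "\<exists>K' c. K' > 0 \<and> c > 0 \<and> (\<forall>n w I v. n \<ge> 2 \<and> weights_ok \<epsilon> A n w \<and> values_ok \<delta> n I v \<and>
           (\<forall>i\<in>{1..n}. \<bar>v i\<bar> \<le> B) \<longrightarrow>
           (\<forall>L. measure_pmf.prob (perm_pmf n)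
                {\<pi>. \<bar>perm_sum n w v \<pi> - L\<bar> \<le> 1 / real n powr (3/2 - \<epsilon>)}
              \<le> K' / real n powr (3/2 - \<epsilon>) * exp (- c * L\<^sup>2)))"
    if B: "B > 0" for A B :: real
  proof -
    \<comment> \<open>Enough residue classes that each contains at most \<eta> n + 1
      positions.\<close>
    define m where "m = Suc (nat \<lceil>1 / \<eta>\<rceil>)"
    have m0: "m > 0" by (simp add: m_def)
    have "1 / \<eta> \<le> real m" unfolding m_def by linarith
    hence m: "1 / real m \<le> \<eta>" using eta m0 by (simp add: field_simps)
    \<comment> \<open>The subgaussian exponent at the level |L| / (2 m) demanded of one partial
      sum.\<close>
    define c where "c = 1 / (64 * B\<^sup>2) / (2 * real m)\<^sup>2"
    \<comment> \<open>The maximum serves two cases: for |L| \<le> 2 the factor exp (4 c) undoes the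
      Gaussian, and for larger |L| a union bound over \<open>m\<close> classes is used.\<close>
    define K' where "K' = max (K * exp (c * 4)) (real m * 2 * K)"
    have c: "c > 0" using B m0 by (simp add: c_def)
    have K': "K' > 0" using K by (simp add: K'_def less_max_iff_disj)
    have "measure_pmf.prob (perm_pmf n) {\<pi>. \<bar>perm_sum n w v \<pi> - L\<bar> \<le> 1 / real n powr (3/2 - \<epsilon>)}
              \<le> K' / real n powr (3/2 - \<epsilon>) * exp (- c * L\<^sup>2)"
      if n: "n \<ge> 2" and w: "weights_ok \<epsilon> A n w" and v: "values_ok \<delta> n I v"
        and vB: "\<forall>i\<in>{1..n}. \<bar>v i\<bar> \<le> B" for n w I v L
    proof -
      define r where "r = 1 / real n powr (3/2 - \<epsilon>)"
      have r: "1 / real n powr (3/2) \<le> r" unfolding r_def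
        using n assms by (intro divide_left_mono powr_mono) auto
      have "1 \<le> real n powr (3/2 - \<epsilon>)" using n assms by (intro ge_one_powr_ge_zero) auto
      hence r1: "0 < r" "r \<le> 1" using n by (auto simp: r_def divide_le_eq)
      have "measure_pmf.prob (perm_pmf n) {\<pi>. \<bar>perm_sum n w v \<pi> - L\<bar> \<le> r} \<le> K' * r * exp (- c * L\<^sup>2)"
      proof (cases "\<bar>L\<bar> \<le> 2")
        case True
        hence "\<bar>L\<bar>\<^sup>2 \<le> 2\<^sup>2" by (intro power_mono) auto
        hence "c * L\<^sup>2 \<le> c * 4" using c by (intro mult_left_mono) auto
        hence e: "1 \<le> exp (c * 4) * exp (- c * L\<^sup>2)" by (simp flip: exp_add)
        have "measure_pmf.prob (perm_pmf n) {\<pi>. \<bar>perm_sum n w v \<pi> - L\<bar> \<le> r} \<le> K * r * 1"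
          using small[OF n w v r] by simp
        also have "\<dots> \<le> K * r * (exp (c * 4) * exp (- c * L\<^sup>2))"
          using K r1 e by (intro mult_left_mono) auto
        also have "\<dots> = (K * exp (c * 4)) * r * exp (- c * L\<^sup>2)" by simp
        also have "\<dots> \<le> K' * r * exp (- c * L\<^sup>2)"
          using r1 by (intro mult_right_mono) (auto simp: K'_def)
        finally show ?thesis .
      next
        case False
        define T where "T j = {i\<in>{1..n}. i mod m = j}" for j
        define y where "y = \<bar>L\<bar> / (2 * real m)"
        define X where "X j \<pi> = (\<Sum>i\<in>T j. w i * v (\<pi> i)) - (\<Sum>i\<in>T j. w i) * (\<Sum>i=1..n. v i) / real n"
          for j and \<pi> :: "nat \<Rightarrow> nat"
        have y0: "y \<ge> 0" by (simp add: y_def)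
        have group: "(\<Sum>j<m. \<Sum>i\<in>T j. f i) = (\<Sum>i=1..n. f i)" for f :: "nat \<Rightarrow> real"
          unfolding T_def using m0 by (intro sum.group) auto
        \<comment> \<open>The centring terms cancel over all classes because the weights sum to
          zero.\<close>
        have X: "(\<Sum>j<m. X j \<pi>) = perm_sum n w v \<pi>" for \<pi>
          using w by (simp add: X_def sum_subtractf sum_distrib_right[symmetric]
              sum_divide_distrib[symmetric] group perm_sum_def weights_ok_def)
        let ?E = "\<lambda>j. {\<pi>. y \<le> \<bar>X j \<pi>\<bar> \<and> \<bar>perm_sum n w v \<pi> - L\<bar> \<le> r}"
        \<comment> \<open>Since r \<le> 1 and |L| > 2, closeness to \<open>L\<close> forces |S| >
          |L| / 2, so one of the \<open>m\<close> centred partial sums has absolute value at least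
          |L| / (2 m).\<close>
        have "{\<pi>. \<bar>perm_sum n w v \<pi> - L\<bar> \<le> r} \<subseteq> (\<Union>j<m. ?E j)"
        proof
          fix \<pi> assume "\<pi> \<in> {\<pi>. \<bar>perm_sum n w v \<pi> - L\<bar> \<le> r}"
          hence \<pi>: "\<bar>perm_sum n w v \<pi> - L\<bar> \<le> r" by simp
          have "\<exists>j<m. y \<le> \<bar>X j \<pi>\<bar>"
          proof (rule ccontr)
            assume "\<not> ?thesis"
            hence "(\<Sum>j<m. \<bar>X j \<pi>\<bar>) < (\<Sum>j<m. y)" using m0 by (intro sum_strict_mono) auto
            also have "\<dots> = \<bar>L\<bar> / 2" using m0 by (simp add: y_def)
            finally have "\<bar>perm_sum n w v \<pi>\<bar> < \<bar>L\<bar> / 2"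
              unfolding X[symmetric] by (rule le_less_trans[OF sum_abs])
            thus False using \<pi> r1 False by linarith
          qed
          thus "\<pi> \<in> (\<Union>j<m. ?E j)" using \<pi> by auto
        qed
        hence "measure_pmf.prob (perm_pmf n) {\<pi>. \<bar>perm_sum n w v \<pi> - L\<bar> \<le> r}
            \<le> measure_pmf.prob (perm_pmf n) (\<Union>j<m. ?E j)"
          by (intro measure_pmf.finite_measure_mono) auto
        also have "\<dots> \<le> (\<Sum>j<m. measure_pmf.prob (perm_pmf n) (?E j))"
          by (intro measure_pmf.finite_measure_subadditive_finite) auto
        also have "\<dots> \<le> (\<Sum>j<m. 2 * exp (- (y\<^sup>2 / (64 * B\<^sup>2))) * (K * r))"
        proof (intro sum_mono)
          fix j
          have T: "T j \<subseteq> {1..n}" by (auto simp: T_def)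
          have "real (card (T j)) \<le> real n / real m + 1" unfolding T_def by (rule card_mod_class_le[OF m0])
          also have "real n / real m \<le> \<eta> * real n"
            using mult_right_mono[OF m, of "real n"] by simp
          finally have cT: "real (card (T j)) \<le> \<eta> * real n + 1" by simp
          obtain qs where qs: "distinct qs" "set qs = {1..n} - T j"
            "\<forall>r L ys. 1 / real n powr (3/2) \<le> r \<longrightarrow> distinct ys \<longrightarrow> set ys \<subseteq> {1..n} \<longrightarrow> length ys = card (T j) \<longrightarrow>
              perm_avg ({1..n} - set ys) (\<lambda>zs. of_bool (\<bar>wsum v (map w qs) zs - L\<bar> \<le> r)) \<le> K * r"
            using core[OF n w v T cT] by blast
          show "measure_pmf.prob (perm_pmf n) (?E j) \<le> 2 * exp (- (y\<^sup>2 / (64 * B\<^sup>2))) * (K * r)"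
            unfolding X_def
          proof (rule prob_tail_inter_small_ball_le[OF T _ _ B y0 _ qs(1,2)])
            show "(\<Sum>i=1..n. (w i)\<^sup>2) \<le> 1" using w by (simp add: weights_ok_def)
          qed (use vB qs(3) r K r1 in auto)
        qed
        also have "\<dots> = (real m * 2 * K) * r * exp (- (y\<^sup>2 / (64 * B\<^sup>2)))" by simp
        also have "y\<^sup>2 / (64 * B\<^sup>2) = c * L\<^sup>2"
          by (simp add: y_def c_def power_divide power_mult_distrib)
        also have "(real m * 2 * K) * r * exp (- (c * L\<^sup>2)) \<le> K' * r * exp (- (c * L\<^sup>2))"
          using r1 by (intro mult_right_mono) (auto simp: K'_def)
        finally show ?thesis by simp
      qed
      thus ?thesis by (simp add: r_def)
    qed
    thus ?thesis using K' c by (intro exI[of _ K'] exI[of _ c] conjI) auto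
  qed
  have part_a: "measure_pmf.prob (perm_pmf n) {\<pi>. \<bar>perm_sum n w v \<pi> - L\<bar> \<le> 1 / real n powr (3/2)}
      \<le> K / real n powr (3/2)"
    if "n \<ge> 2" "weights_ok \<epsilon> A n w" "values_ok \<delta> n I v" for n w I v A L
    using small[OF that order.refl] by simp
  show ?thesis
  proof (rule exI[of _ 1], intro conjI allI impI, goal_cases)
    case (2 A)
    show ?case using part_a by (intro exI[of _ K] allI impI) (elim conjE)
  next
    case (3 A B)
    from 3(2) show ?case by (rule part_b)
  qed simp
qed

end
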